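(* Let $a,k,d,e,f$ be integers with $1\le a\le k$, $1\le d\le k$, $1\le f\le d$, and either $e=d$ or $2e=d$. Let ${}_dB_{dk+e,\,da+f}(n)$ be the number of partitions of $n$ such that $$\phi_i+\phi_{i+1}<dk+e \ \text{ for all } i\ge 1,\qquad \phi_1<da+f,\qquad d\mid \phi_{2i}\ \text{ for all } i\ge 1.$$ Put $M=2dk+2e+d$. Then $\sum_{n\ge 0}{}_dB_{dk+e,\,da+f}(n)\,q^n$ equals: - if $f<e$: $$\frac{1}{(q^{2d};q^{2d})_\infty (q;q^2)_\infty}\left(\frac{1-q^{d-e+f}}{1-q^d}\,(q^{da+e},q^{2dk-da+e+d},q^{M};q^{M})_\infty+\frac{q^{d-e+f}-q^d}{1-q^d}\,(q^{d(a-1)+e},q^{2dk-da+e+2d},q^{M};q^{M})_\infty\right);$$ - if $f=e$: $$\frac{(q^{da+e},q^{2dk-da+e+d},q^{M};q^{M})_\infty}{(q^{2d};q^{2d})_\infty (q;q^2)_\infty};$$ - if $f>e$: $$\frac{1}{(q^{2d};q^{2d})_\infty (q;q^2)_\infty}\left(\frac{q^{f-e}-q^d}{1-q^d}\,(q^{da+e},q^{2dk-da+e+d},q^{M};q^{M})_\infty+\frac{1-q^{f-e}}{1-q^d}\,(q^{d(a+1)+e},q^{2dk-da+e},q^{M};q^{M})_\infty\right).$$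
   Context: A partition of a nonnegative integer $n$ is a finite non-increasing sequence of positive integers summing to $n$ (the empty partition is the unique partition of $0$). For a partition and an integer $i\ge1$, $\phi_i$ denotes the number of times $i$ occurs as a part (so $\phi_i\ge 0$). For $|q|<1$: $(a;q)_n=(1-a)(1-aq)\cdots(1-aq^{n-1})$, $(a;q)_\infty=\lim_{n\to\infty}(a;q)_n$, and $(a_1,\dots,a_r;q)_\infty=(a_1;q)_\infty\cdots(a_r;q)_\infty$. The identity is of formal power series in $q$ (equivalently of analytic functions for $|q|<1$). *)

theory Defs
  imports "HOL-Analysis.Analysis"
begin

text \<open>A partition of n is encoded by its multiplicity function phi, where phi i is
  the number of times the part i occurs. Parts are positive integers, so phi 0 = 0,
  and every part is at most n. This is a bijection with partitions of n.\<close>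
definition is_partition_mult :: "(nat \<Rightarrow> nat) \<Rightarrow> nat \<Rightarrow> bool" where
  "is_partition_mult phi n \<longleftrightarrow>
     (\<forall>i. phi i \<noteq> 0 \<longrightarrow> 1 \<le> i \<and> i \<le> n) \<and> (\<Sum>i=1..n. i * phi i) = n"

definition dB :: "nat \<Rightarrow> nat \<Rightarrow> nat \<Rightarrow> nat \<Rightarrow> nat" where
  "dB d K A n = card {phi. is_partition_mult phi n \<and>
      (\<forall>i\<ge>1. phi i + phi (i + 1) < K) \<and> phi 1 < A \<and>
      (\<forall>i\<ge>1. d dvd phi (2 * i))}"

definition qpoch_inf :: "complex \<Rightarrow> complex \<Rightarrow> complex" where
  "qpoch_inf a q = (\<Prod>n. (1 - a * q ^ n))"

end

theory Submission
  imports Defs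
begin

text \<open>
  Removing the parts \<open>1\<close> and \<open>2\<close> from an admissible partition leaves one with parts greater than
  \<open>2\<close> of the same kind, so the generating functions of partitions with parts greater than \<open>2 N\<close> satisfy a
  linear recurrence in \<open>N\<close>, and they tend to \<open>1\<close> as \<open>N\<close> grows; this determines them. Only the bounds
  \<open>d a + e\<close> on the multiplicity of the smallest part occur on the right-hand side of the recurrence. For
  these bounds it is solved by an explicit series of Gordon type, divided by the tail of the
  denominator product; the boundary condition at \<open>a = 0\<close> is where \<open>e = d\<close> or \<open>2 e = d\<close> enters. At \<open>N = 0\<close> the
  series is a theta series, which the Jacobi triple product evaluates. Between two consecutive bounds
  \<open>d a + e\<close> the generating function grows by a geometric progression, which gives the interpolated
  formulas for \<open>f < e\<close> and \<open>f > e\<close>.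
\<close>

section \<open>The Jacobi triple product\<close>

text \<open>Write \<open>y = q ^ (2 * N + 1)\<close> and \<open>K = d * k + e\<close>. If
  \<open>2 * N + 2\<close> occurs \<open>d * m\<close> times, the next odd part may occur fewer than
  \<open>K - d * m = d * (k - m) + e\<close> times; hence the bounds \<open>d * a + e\<close> form a
  closed system. For them the pairs of multiplicities fall into blocks of rows, the first with
  \<open>e\<close> rows, each later one with \<open>d\<close>, and the range of \<open>m\<close> is
  constant on a block. A block contributes a geometric sum in \<open>y\<close> times a sum over
  \<open>m\<close>, and comparing neighbouring blocks leaves a second order equation in
  \<open>a\<close>. At its top end, raising the bound beyond \<open>K\<close> changes nothing. At
  its bottom end the first block has length \<open>e\<close> while the equation speaks of blocks of
  length \<open>d\<close>; the series meets this condition term by term in the two cases for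
  \<open>e\<close>. Convergence is not presupposed: parts are also cut off at
  \<open>2 * (N + L)\<close>, so all sums are finite, and the limit in \<open>L\<close> is
  controlled by the same polynomials at \<open>norm q\<close>. A bound not of the form
  \<open>d * a + e\<close> enters only in the removal of the parts 1 and 2.\<close>

lemma summable_norm_ratio_zero:
  fixes f g :: "nat \<Rightarrow> 'a :: real_normed_field"
  assumes "\<And>n. f (Suc n) = f n * g n" "g \<longlonglongrightarrow> 0"
  shows "summable (\<lambda>n. norm (f n))"
proof -
  have "eventually (\<lambda>n. norm (g n) < 1/2) sequentially"
    using assms(2) by (intro order_tendstoD(2)[of _ 0]) (auto intro: tendsto_norm_zero)
  then obtain N where N: "\<And>n. n \<ge> N \<Longrightarrow> norm (g n) < 1/2"
    by (auto simp: eventually_sequentially)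
  show ?thesis
  proof (rule summable_ratio_test[of "1/2" N])
    fix n assume "n \<ge> N"
    then have "norm (f n) * norm (g n) \<le> norm (f n) * (1/2)"
      using N[of n] by (intro mult_left_mono) auto
    then show "norm (norm (f (Suc n))) \<le> 1/2 * norm (norm (f n))"
      by (simp add: assms(1) norm_mult)
  qed auto
qed

definition qpoch :: "complex \<Rightarrow> complex \<Rightarrow> nat \<Rightarrow> complex" where
  "qpoch a q n = (\<Prod>i<n. 1 - a * q ^ i)"

lemma qpoch_0 [simp]: "qpoch a q 0 = 1"
  by (simp add: qpoch_def)

lemma qpoch_Suc: "qpoch a q (Suc n) = qpoch a q n * (1 - a * q ^ n)"
  by (simp add: qpoch_def)

lemma convergent_prod_qpoch:
  fixes a q :: complex
  assumes "norm q < 1"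
  shows "convergent_prod (\<lambda>n. 1 - a * q ^ n)"
  by (intro abs_convergent_prod_imp_convergent_prod summable_imp_abs_convergent_prod)
     (use assms in \<open>auto simp: norm_mult norm_power intro!: summable_mult summable_geometric\<close>)

lemma qpoch_tendsto:
  assumes "norm q < 1"
  shows "qpoch a q \<longlonglongrightarrow> qpoch_inf a q"
proof -
  have "(\<lambda>n. qpoch a q (Suc n)) \<longlonglongrightarrow> qpoch_inf a q"
    using convergent_prod_LIMSEQ[OF convergent_prod_qpoch[OF assms, of a]]
    by (simp add: qpoch_def qpoch_inf_def lessThan_Suc_atMost)
  then show ?thesis by (rule LIMSEQ_imp_Suc)
qed

lemma power_neq_one:
  fixes q :: complex
  assumes "norm q < 1" "n > 0"
  shows "q ^ n \<noteq> 1"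
proof
  assume "q ^ n = 1"
  then have "norm q ^ n = 1" by (metis norm_one norm_power)
  moreover have "norm q ^ n < 1"
    using assms by (simp add: power_less_one_iff)
  ultimately show False by simp
qed

lemma qpoch_nonzero:
  assumes "\<And>i. a * q ^ i \<noteq> 1"
  shows "qpoch a q n \<noteq> 0"
  using assms by (auto simp: qpoch_def)

lemma qpoch_inf_nonzero:
  assumes "norm q < 1" "\<And>i. a * q ^ i \<noteq> 1"
  shows "qpoch_inf a q \<noteq> 0"
  unfolding qpoch_inf_def
  by (rule prodinf_nonzero[OF convergent_prod_qpoch]) (use assms in auto)

section \<open>Gaussian binomial coefficients and the finite product formula\<close>

fun qbinomial :: "complex \<Rightarrow> nat \<Rightarrow> nat \<Rightarrow> complex" where
  "qbinomial q n 0 = 1"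
| "qbinomial q 0 (Suc j) = 0"
| "qbinomial q (Suc n) (Suc j) = q ^ Suc j * qbinomial q n (Suc j) + qbinomial q n j"

lemma qbinomial_eq_0: "j > n \<Longrightarrow> qbinomial q n j = 0"
  by (induction q n j rule: qbinomial.induct) auto

lemma choose_two_Suc: "Suc n choose 2 = (n choose 2) + n"
  by (simp add: numeral_2_eq_2)

theorem qbinomial_theorem:
  "(\<Prod>i<n. 1 + x * q ^ i) = (\<Sum>j\<le>n. qbinomial q n j * q ^ (j choose 2) * x ^ j)"
proof (induction n arbitrary: x)
  case 0
  then show ?case by (simp add: binomial_eq_0)
next
  case (Suc n)
  let ?c = "\<lambda>j. qbinomial q n j * q ^ (j choose 2) * (x * q) ^ j"
  have "(\<Prod>i<Suc n. 1 + x * q ^ i) = (1 + x) * (\<Prod>i<n. 1 + (x * q) * q ^ i)"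
    by (subst prod.lessThan_Suc_shift) (simp add: mult_ac)
  also have "\<dots> = (\<Sum>j\<le>n. ?c j) + (\<Sum>j\<le>n. x * ?c j)"
    by (subst Suc) (simp add: distrib_right sum_distrib_left sum.distrib)
  also have "(\<Sum>j\<le>n. ?c j) = (\<Sum>j\<le>Suc n. ?c j)"
    by (simp add: qbinomial_eq_0)
  also have "\<dots> = 1 + (\<Sum>j\<le>n. ?c (Suc j))"
    by (subst sum.atMost_Suc_shift) (simp add: binomial_eq_0)
  also have "1 + (\<Sum>j\<le>n. ?c (Suc j)) + (\<Sum>j\<le>n. x * ?c j)
      = 1 + (\<Sum>j\<le>n. qbinomial q (Suc n) (Suc j) * q ^ (Suc j choose 2) * x ^ Suc j)"
    unfolding add.assoc sum.distrib[symmetric]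
    by (intro arg_cong2[of _ _ _ _ "(+)"] sum.cong refl)
       (simp add: choose_two_Suc power_add power_mult_distrib algebra_simps)
  also have "\<dots> = (\<Sum>j\<le>Suc n. qbinomial q (Suc n) j * q ^ (j choose 2) * x ^ j)"
    by (subst sum.atMost_Suc_shift) (simp add: binomial_eq_0)
  finally show ?case .
qed

text \<open>The Pascal rule splits \<open>1 - q ^ (i + j)\<close> as
  \<open>q ^ j * (1 - q ^ i) + (1 - q ^ j)\<close>. Stated as a product, the formula needs no
  nonvanishing of \<open>qpoch\<close>.\<close>

lemma qbinomial_mult_qpoch:
  "qbinomial q (i + j) j * (qpoch q q j * qpoch q q i) = qpoch q q (i + j)"
proof (induction "i + j" arbitrary: i j)
  case 0
  then show ?case by simp
next
  case (Suc n)
  show ?case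
  proof (cases j)
    case 0
    then show ?thesis by simp
  next
    case (Suc j')
    show ?thesis
    proof (cases i)
      case 0
      have "qbinomial q m m = 1" for m
        by (induction m) (auto simp: qbinomial_eq_0)
      then show ?thesis using 0 by simp
    next
      case (Suc i')
      have n: "n = i' + j" "n = i + j'"
        using \<open>Suc n = i + j\<close> \<open>j = Suc j'\<close> Suc by auto
      have 1: "qbinomial q n j * (qpoch q q j * qpoch q q i') = qpoch q q n"
        using Suc.hyps(1)[OF n(1)] n by simp
      have 2: "qbinomial q n j' * (qpoch q q j' * qpoch q q i) = qpoch q q n"
        using Suc.hyps(1)[OF n(2)] n by simp
      have i: "qpoch q q i = qpoch q q i' * (1 - q ^ i)"
        and j: "qpoch q q j = qpoch q q j' * (1 - q ^ j)"
        using Suc \<open>j = Suc j'\<close> by (simp_all add: qpoch_Suc)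
      have "qbinomial q (i + j) j = q ^ j * qbinomial q n j + qbinomial q n j'"
        using \<open>j = Suc j'\<close> n by simp
      then have "qbinomial q (i + j) j * (qpoch q q j * qpoch q q i)
         = q ^ j * (1 - q ^ i) * (qbinomial q n j * (qpoch q q j * qpoch q q i'))
           + (1 - q ^ j) * (qbinomial q n j' * (qpoch q q j' * qpoch q q i))"
        by (simp add: i j algebra_simps)
      also have "\<dots> = qpoch q q n * (1 - q ^ (i + j))"
        unfolding 1 2 by (simp add: power_add algebra_simps)
      also have "\<dots> = qpoch q q (i + j)"
        using \<open>Suc n = i + j\<close> by (metis power_Suc qpoch_Suc)
      finally show ?thesis .
    qed
  qed
qed

lemma sum_atMost_double_split:
  fixes g :: "nat \<Rightarrow> 'a :: comm_monoid_add"
  shows "(\<Sum>j\<le>2 * n. g j) = (\<Sum>m\<le>n. g (n - m)) + (\<Sum>m<n. g (n + 1 + m))"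
proof -
  have "(\<Sum>j\<le>2 * n. g j) = (\<Sum>j\<in>{..n} \<union> {n<..2*n}. g j)"
    by (intro sum.cong) auto
  also have "\<dots> = (\<Sum>j\<le>n. g j) + (\<Sum>j\<in>{n<..2*n}. g j)"
    by (rule sum.union_disjoint) auto
  also have "(\<Sum>j\<le>n. g j) = (\<Sum>m\<le>n. g (n - m))"
    by (rule sum.reindex_bij_witness[of _ "\<lambda>m. n - m" "\<lambda>m. n - m"]) auto
  also have "(\<Sum>j\<in>{n<..2*n}. g j) = (\<Sum>m<n. g (n + 1 + m))"
    by (rule sum.reindex_bij_witness[of _ "\<lambda>m. n + 1 + m" "\<lambda>j. j - n - 1"]) auto
  finally show ?thesis .
qed

text \<open>With \<open>choose_two_add\<close> this shows that, counted from the middle of row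
  \<open>2 * n\<close>, the terms with \<open>z\<close>-exponents \<open>- m\<close> and
  \<open>m + 1\<close> carry the same triangular power of \<open>p\<close>.\<close>

lemma choose_two_diff:
  assumes "m \<le> n"
  shows "((n - m) choose 2) + (Suc n choose 2) = n * (n - m) + (Suc m choose 2)"
proof -
  obtain i where n: "n = m + i" using assms le_Suc_ex by blast
  show ?thesis unfolding n
    by (induction i) (auto simp: choose_two_Suc algebra_simps)
qed

lemma choose_two_add:
  "((n + 1 + m) choose 2) + (Suc n choose 2) = n * (n + 1 + m) + (Suc m choose 2)"
  by (induction n) (auto simp: choose_two_Suc algebra_simps)

text \<open>This is \<open>qbinomial_theorem\<close> with \<open>2 * n\<close> factors at
  \<open>x = - z / p ^ n\<close>: the upper \<open>n\<close> factors form
  \<open>qpoch z p n\<close>, and the lower ones become \<open>qpoch (p / z) p n\<close> once a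
  monomial is extracted from each. Indexing from the middle splits the sum into two one-sided
  ones.\<close>

lemma jacobi_triple_product_finite:
  fixes p z :: complex
  assumes "p \<noteq> 0" "z \<noteq> 0"
  shows "qpoch z p n * qpoch (p / z) p n =
    (\<Sum>m\<le>n. (-1) ^ m * p ^ (Suc m choose 2) * (inverse z ^ m * qbinomial p (2*n) (n - m)))
    + (\<Sum>m<n. (-1) ^ m * p ^ (Suc m choose 2) * (- (z ^ Suc m) * qbinomial p (2*n) (n + 1 + m)))"
proof -
  \<comment> \<open>The product of the monomials \<open>p ^ Suc i / (- z)\<close> over
    \<open>i < n\<close>, each of which turns \<open>1 - z / p ^ Suc i\<close> into
    \<open>1 - p ^ Suc i / z\<close>.\<close>
  define c where "c = p ^ (Suc n choose 2) / (- z) ^ n"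
  let ?x = "- z / p ^ n"
  have "(\<Prod>i<2*n. 1 + ?x * p ^ i) = (\<Prod>i<n. 1 + ?x * p ^ i) * qpoch z p n"
  proof -
    have "(\<Prod>i<n + m. 1 + ?x * p ^ i) = (\<Prod>i<n. 1 + ?x * p ^ i) * qpoch z p m" for m
      by (induction m) (use assms in \<open>auto simp: qpoch_Suc power_add\<close>)
    from this[of n] show ?thesis by (simp add: mult_2)
  qed
  also have "(\<Prod>i<n. 1 + ?x * p ^ i) = (\<Prod>i<n. 1 - z / p ^ Suc i)"
  proof -
    have "(\<Prod>i<n. 1 + ?x * p ^ i) = (\<Prod>i<n. 1 + ?x * p ^ (n - Suc i))"
      by (rule prod.nat_diff_reindex[symmetric])
    also have "\<dots> = (\<Prod>i<n. 1 - z / p ^ Suc i)"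
    proof (intro prod.cong refl)
      fix i assume "i \<in> {..<n}"
      then have "p ^ n = p ^ (n - Suc i) * p ^ Suc i"
        by (metis Suc_leI lessThan_iff power_add le_add_diff_inverse2)
      then show "1 + ?x * p ^ (n - Suc i) = 1 - z / p ^ Suc i"
        using assms by (simp add: field_simps)
    qed
    finally show ?thesis .
  qed
  finally have A: "(\<Prod>i<2*n. 1 + ?x * p ^ i) = (\<Prod>i<n. 1 - z / p ^ Suc i) * qpoch z p n" .
  have B: "c * (\<Prod>i<n. 1 - z / p ^ Suc i) = qpoch (p / z) p n"
    unfolding c_def
  proof (induction n)
    case 0
    then show ?case by (simp add: binomial_eq_0)
  next
    case (Suc n)
    have "p ^ (Suc (Suc n) choose 2) / (- z) ^ Suc n * (\<Prod>i<Suc n. 1 - z / p ^ Suc i)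
        = (p ^ (Suc n choose 2) / (- z) ^ n * (\<Prod>i<n. 1 - z / p ^ Suc i))
           * (p ^ Suc n / (- z) * (1 - z / p ^ Suc n))"
      by (simp add: choose_two_Suc[of "Suc n"] power_add mult_ac)
    also have "p ^ Suc n / (- z) * (1 - z / p ^ Suc n) = 1 - p / z * p ^ n"
      using assms by (simp add: field_simps)
    finally show ?case unfolding Suc qpoch_Suc .
  qed
  let ?g = "\<lambda>j. c * (qbinomial p (2*n) j * p ^ (j choose 2) * ?x ^ j)"
  have "qpoch z p n * qpoch (p / z) p n = (\<Sum>j\<le>2*n. ?g j)"
    by (subst sum_distrib_left[symmetric], subst qbinomial_theorem[symmetric])
       (simp only: A B[symmetric], simp only: mult_ac)
  also have "\<dots> = (\<Sum>m\<le>n. ?g (n - m)) + (\<Sum>m<n. ?g (n + 1 + m))"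
    by (rule sum_atMost_double_split)
  also have "(\<Sum>m\<le>n. ?g (n - m)) =
     (\<Sum>m\<le>n. (-1) ^ m * p ^ (Suc m choose 2) * (inverse z ^ m * qbinomial p (2*n) (n - m)))"
  proof (intro sum.cong refl)
    fix m assume "m \<in> {..n}"
    then have m: "m \<le> n" by simp
    have "p ^ ((n - m) choose 2) * p ^ (Suc n choose 2) = p ^ (n * (n - m)) * p ^ (Suc m choose 2)"
      using choose_two_diff[OF m] by (simp only: power_add[symmetric])
    then have P: "p ^ (Suc n choose 2) * p ^ ((n - m) choose 2) / p ^ (n * (n - m)) = p ^ (Suc m choose 2)"
      using assms by (simp add: field_simps)
    have "(-z) ^ n = (-z) ^ (n - m) * (-z) ^ m"
      using m by (metis power_add le_add_diff_inverse2)
    then have Z: "(-z) ^ (n - m) / (-z) ^ n = (-1) ^ m * inverse z ^ m"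
      using assms by (simp add: power_minus[of z m] field_simps)
    have "?g (n - m) = qbinomial p (2*n) (n - m) *
       (p ^ (Suc n choose 2) * p ^ ((n - m) choose 2) / p ^ (n * (n - m))) * ((-z) ^ (n - m) / (-z) ^ n)"
      unfolding c_def power_divide power_mult[symmetric] by (simp add: mult_ac)
    then show "?g (n - m) =
      (-1) ^ m * p ^ (Suc m choose 2) * (inverse z ^ m * qbinomial p (2*n) (n - m))"
      unfolding P Z by (simp add: mult_ac)
  qed
  also have "(\<Sum>m<n. ?g (n + 1 + m)) =
     (\<Sum>m<n. (-1) ^ m * p ^ (Suc m choose 2) * (- (z ^ Suc m) * qbinomial p (2*n) (n + 1 + m)))"
  proof (intro sum.cong refl)
    fix m assume "m \<in> {..<n}"
    have "p ^ ((n + 1 + m) choose 2) * p ^ (Suc n choose 2) = p ^ (n * (n + 1 + m)) * p ^ (Suc m choose 2)"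
      using choose_two_add[of n m] by (simp only: power_add[symmetric])
    then have P: "p ^ (Suc n choose 2) * p ^ ((n + 1 + m) choose 2) / p ^ (n * (n + 1 + m)) = p ^ (Suc m choose 2)"
      using assms by (simp add: field_simps)
    have "(-z) ^ (n + 1 + m) = (-z) ^ n * (-z) ^ Suc m"
      by (simp add: power_add)
    then have Z: "(-z) ^ (n + 1 + m) / (-z) ^ n = (-1) ^ m * (- (z ^ Suc m))"
      using assms by (simp add: power_minus[of z m] field_simps)
    have "?g (n + 1 + m) = qbinomial p (2*n) (n + 1 + m) *
       (p ^ (Suc n choose 2) * p ^ ((n + 1 + m) choose 2) / p ^ (n * (n + 1 + m))) * ((-z) ^ (n + 1 + m) / (-z) ^ n)"
      unfolding c_def power_divide power_mult[symmetric] by (simp add: mult_ac del: qbinomial.simps)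
    then show "?g (n + 1 + m) =
      (-1) ^ m * p ^ (Suc m choose 2) * (- (z ^ Suc m) * qbinomial p (2*n) (n + 1 + m))"
      unfolding P Z by (simp add: mult_ac)
  qed
  finally show ?thesis .
qed

lemma summable_theta_bound:
  fixes t c :: real
  assumes "norm t < 1"
  shows "summable (\<lambda>m. norm (t ^ (Suc m choose 2) * c ^ m))"
proof (rule summable_norm_ratio_zero)
  show "t ^ (Suc (Suc m) choose 2) * c ^ Suc m = t ^ (Suc m choose 2) * c ^ m * (t ^ Suc m * c)" for m
    by (simp add: choose_two_Suc[of "Suc m"] power_add)
  have "(\<lambda>m. t ^ m) \<longlonglongrightarrow> 0"
    using assms by (rule LIMSEQ_power_zero)
  then show "(\<lambda>m. t ^ Suc m * c) \<longlonglongrightarrow> 0"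
    by (intro tendsto_mult_left_zero LIMSEQ_Suc)
qed

text \<open>The binomials at a fixed distance from the middle of row \<open>2 * n\<close> tend to
  \<open>1 / qpoch_inf p p\<close>, and all \<open>q\<close>-binomials are bounded uniformly, so
  Tannery's theorem passes to the limit in the finite form. Pairing the exponents \<open>- m\<close>
  and \<open>m + 1\<close> of \<open>z\<close> gives the one-sided shape in which the Gordon series
  appears at level 0.\<close>

theorem jacobi_triple_product:
  fixes p z :: complex
  assumes p: "p \<noteq> 0" "norm p < 1" and z: "z \<noteq> 0"
  shows "(\<Sum>m. (-1) ^ m * p ^ (Suc m choose 2) * (inverse z ^ m - z ^ Suc m))
           = qpoch_inf z p * qpoch_inf (p / z) p * qpoch_inf p p"
proof -
  have nz: "p * p ^ i \<noteq> 1" for i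
    using power_neq_one[OF p(2), of "Suc i"] by simp
  define c where "c = qpoch_inf p p"
  have c0: "c \<noteq> 0" unfolding c_def by (rule qpoch_inf_nonzero[OF p(2) nz])
  have lim: "qpoch p p \<longlonglongrightarrow> c" unfolding c_def by (rule qpoch_tendsto[OF p(2)])
  have nz': "qpoch p p i \<noteq> 0" for i by (rule qpoch_nonzero[OF nz])
  have qb: "qbinomial p (i + j) j = qpoch p p (i + j) * inverse (qpoch p p j) * inverse (qpoch p p i)" for i j
    using qbinomial_mult_qpoch[of p i j] nz'[of i] nz'[of j] by (simp add: field_simps)
  have "Bseq (qpoch p p)"
    using lim by (intro convergent_imp_Bseq convergentI)
  then obtain C1 where C1: "C1 > 0" "\<And>n. norm (qpoch p p n) \<le> C1"
    by (auto simp: Bseq_def)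
  have "Bseq (\<lambda>n. inverse (qpoch p p n))"
    using lim c0 by (intro convergent_imp_Bseq convergentI[of _ "inverse c"] tendsto_inverse)
  then obtain C2 where C2: "C2 > 0" "\<And>n. norm (inverse (qpoch p p n)) \<le> C2"
    by (auto simp: Bseq_def)
  define C where "C = C1 * C2 * C2"
  have C0: "C \<ge> 0" using C1 C2 by (simp add: C_def)
  have bd: "norm (qbinomial p n j) \<le> C" for n j
  proof (cases "j \<le> n")
    case True
    then obtain i where n: "n = i + j" using le_Suc_ex by (metis add.commute)
    show ?thesis unfolding n qb norm_mult C_def
      using C1 C2 by (intro mult_mono mult_nonneg_nonneg) auto
  qed (use C0 in \<open>simp add: qbinomial_eq_0\<close>)
  \<comment> \<open>At \<open>m = n\<close> the second binomial vanishes, so both sums of the finite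
    form can run over \<open>m \<le> n\<close>.\<close>
  let ?u = "\<lambda>m n. if m \<le> n then inverse z ^ m * qbinomial p (2*n) (n - m)
                   - z ^ Suc m * qbinomial p (2*n) (n + 1 + m) else 0"
  let ?a = "\<lambda>m n. (-1) ^ m * p ^ (Suc m choose 2) * ?u m n"
  let ?b = "\<lambda>m. (-1) ^ m * p ^ (Suc m choose 2) * (inverse z ^ m * inverse c - z ^ Suc m * inverse c)"
  let ?M = "\<lambda>m. C * norm (norm p ^ (Suc m choose 2) * norm (inverse z) ^ m)
                + C * norm z * norm (norm p ^ (Suc m choose 2) * norm z ^ m)"
  have s: "strict_mono (\<lambda>n::nat. 2 * n)"
    by (auto intro: strict_monoI)
  have l2: "(\<lambda>n. qpoch p p (2 * n)) \<longlonglongrightarrow> c"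
    using LIMSEQ_subseq_LIMSEQ[OF lim s] by (simp add: o_def)
  have lplus: "(\<lambda>n. qpoch p p (n + i)) \<longlonglongrightarrow> c" for i
    using LIMSEQ_ignore_initial_segment[OF lim] .
  have lminus: "(\<lambda>n. qpoch p p (n - i)) \<longlonglongrightarrow> c" for i
    by (rule LIMSEQ_offset[of _ i]) (simp add: lim)
  have lim_a: "(\<lambda>n. ?a m n) \<longlonglongrightarrow> ?b m" for m
  proof -
    let ?v = "\<lambda>n. inverse z ^ m * (qpoch p p (2*n) * inverse (qpoch p p (n - m)) * inverse (qpoch p p (n + m)))
       - z ^ Suc m * (qpoch p p (2*n) * inverse (qpoch p p (n + (1 + m))) * inverse (qpoch p p (n - (1 + m))))"
    have ev: "eventually (\<lambda>n. ?v n = ?u m n) sequentially"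
      using eventually_ge_at_top[of "Suc m"]
    proof eventually_elim
      case (elim n)
      then have e: "2 * n = (n + m) + (n - m)" "2 * n = (n - (1 + m)) + (n + 1 + m)" by auto
      show ?case
        using elim qb[of "n + m" "n - m"] qb[of "n - (1 + m)" "n + 1 + m"]
        unfolding e[symmetric] by (simp add: mult_ac)
    qed
    have "?v \<longlonglongrightarrow> inverse z ^ m * (c * inverse c * inverse c) - z ^ Suc m * (c * inverse c * inverse c)"
      by (intro tendsto_intros l2 lplus lminus c0)
    then have "?u m \<longlonglongrightarrow> inverse z ^ m * inverse c - z ^ Suc m * inverse c"
      using c0 by (intro Lim_transform_eventually[OF _ ev]) simp
    then show ?thesis by (intro tendsto_mult_left)
  qed
  have bound: "norm (?a m n) \<le> ?M m" for m n
  proof -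
    have "norm (?u m n) \<le> norm (inverse z) ^ m * C + norm z ^ Suc m * C"
    proof (cases "m \<le> n")
      case True
      then show ?thesis
        by (auto intro!: order.trans[OF norm_triangle_ineq4] add_mono mult_left_mono bd
                 simp del: qbinomial.simps simp: norm_mult norm_power mult.assoc)
    qed (use C0 in simp)
    then have "norm p ^ (Suc m choose 2) * norm (?u m n)
        \<le> norm p ^ (Suc m choose 2) * (norm (inverse z) ^ m * C + norm z ^ Suc m * C)"
      by (intro mult_left_mono) auto
    then show ?thesis
      by (simp add: norm_mult norm_power algebra_simps norm_inverse)
  qed
  have "summable ?M"
    using p by (intro summable_add summable_mult summable_theta_bound) auto
  have T: "eventually (\<lambda>n. summable (\<lambda>m. norm (?a m n))) sequentially \<and>
           summable (\<lambda>m. norm (?b m)) \<and> (\<lambda>n. \<Sum>m. ?a m n) \<longlonglongrightarrow> (\<Sum>m. ?b m)"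
  proof (rule tannerys_theorem[OF lim_a _ \<open>summable ?M\<close>])
    show "eventually (\<lambda>(m, n). norm (?a m n) \<le> ?M m) (sequentially \<times>\<^sub>F sequentially)"
      by (rule always_eventually) (simp only: split_paired_All prod.case bound simp_thms)
  qed (rule sequentially_bot)
  then have "(\<lambda>n. \<Sum>m. ?a m n) \<longlonglongrightarrow> (\<Sum>m. ?b m)" by (elim conjE)
  moreover have "(\<Sum>m. ?a m n) = qpoch z p n * qpoch (p / z) p n" for n
  proof -
    have "(\<Sum>m. ?a m n) = (\<Sum>m\<le>n. ?a m n)"
      by (intro suminf_finite) auto
    also have "\<dots> = (\<Sum>m\<le>n. (-1) ^ m * p ^ (Suc m choose 2) * (inverse z ^ m * qbinomial p (2*n) (n - m)))
       + (\<Sum>m\<le>n. (-1) ^ m * p ^ (Suc m choose 2) * (- (z ^ Suc m) * qbinomial p (2*n) (n + 1 + m)))"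
      unfolding sum.distrib[symmetric] by (intro sum.cong refl) (simp add: algebra_simps)
    also have "(\<Sum>m\<le>n. (-1) ^ m * p ^ (Suc m choose 2) * (- (z ^ Suc m) * qbinomial p (2*n) (n + 1 + m)))
       = (\<Sum>m<n. (-1) ^ m * p ^ (Suc m choose 2) * (- (z ^ Suc m) * qbinomial p (2*n) (n + 1 + m)))"
      by (intro sum.mono_neutral_right) (auto simp: qbinomial_eq_0)
    finally show ?thesis
      unfolding jacobi_triple_product_finite[OF p(1) z] .
  qed
  ultimately have "(\<lambda>n. qpoch z p n * qpoch (p / z) p n) \<longlonglongrightarrow> (\<Sum>m. ?b m)" by simp
  moreover have "(\<lambda>n. qpoch z p n * qpoch (p / z) p n) \<longlonglongrightarrow> qpoch_inf z p * qpoch_inf (p / z) p"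
    by (intro tendsto_mult qpoch_tendsto p)
  ultimately have eq: "qpoch_inf z p * qpoch_inf (p / z) p = (\<Sum>m. ?b m)"
    using LIMSEQ_unique by blast
  let ?t = "\<lambda>m. (-1) ^ m * p ^ (Suc m choose 2) * (inverse z ^ m - z ^ Suc m)"
  have "summable ?b"
    by (rule summable_norm_cancel) (rule T[THEN conjunct2, THEN conjunct1])
  then have "(\<Sum>m. ?b m * c) = (\<Sum>m. ?b m) * c" by (rule suminf_mult2[symmetric])
  also have "(\<lambda>m. ?b m * c) = ?t"
  proof
    fix m
    have "?b m * c = ?t m * (inverse c * c)" by (simp only: left_diff_distrib mult_ac right_diff_distrib)
    then show "?b m * c = ?t m" using c0 by simp
  qed
  finally show ?thesis unfolding eq c_def .
qed

section \<open>A series of Gordon type\<close>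

text \<open>
  The recurrence for the generating functions is, up to a product, a second order difference equation in
  \<open>a\<close> whose inhomogeneity is the same function at \<open>(w s, Y r\<^sup>2)\<close>. The exponentials \<open>r powi (- n a)\<close> and
  \<open>(Y r\<^sup>n) powi a\<close> are permuted by it up to a shift of \<open>n\<close>, and comparing them gives the coefficients.
  The parameters stand for \<open>r = q\<^sup>d\<close>, \<open>s = q\<^bsup>2e\<^esup>\<close>, \<open>w = y\<^sup>e\<close>, \<open>Y = y\<^sup>d\<close> with \<open>y = q\<^bsup>2N+1\<^esup>\<close>.
\<close>
primrec gordon_coeff :: "nat \<Rightarrow> complex \<Rightarrow> complex \<Rightarrow> complex \<Rightarrow> complex \<Rightarrow> nat \<Rightarrow> complex" where
  "gordon_coeff k r s w Y 0 = 1"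
| "gordon_coeff k r s w Y (Suc n) = gordon_coeff k r s w Y n *
     (- (w * Y ^ k * s ^ n * r ^ (k * (2 * n + 1) + n + 1)) * (1 - Y * r ^ n) / (1 - r ^ Suc n))"

text \<open>The index \<open>a\<close> is an integer because the boundary condition at
  \<open>a = 0\<close> refers to \<open>a = -1\<close>.\<close>

definition gordon_term ::
  "nat \<Rightarrow> complex \<Rightarrow> complex \<Rightarrow> complex \<Rightarrow> complex \<Rightarrow> int \<Rightarrow> nat \<Rightarrow> complex" where
  "gordon_term k r s w Y a n =
     gordon_coeff k r s w Y n * ((inverse r ^ n) powi a - w * s ^ n * (Y * r ^ n) powi a)"

definition gordon_series ::
  "nat \<Rightarrow> complex \<Rightarrow> complex \<Rightarrow> complex \<Rightarrow> complex \<Rightarrow> int \<Rightarrow> complex" where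
  "gordon_series k r s w Y a = (\<Sum>n. gordon_term k r s w Y a n)"

locale gordon_base =
  fixes k :: nat and r s :: complex
  assumes r0: "r \<noteq> 0" and r1: "norm r < 1" and s1: "norm s < 1"
begin

abbreviation "al \<equiv> gordon_coeff k r s"
abbreviation "gt \<equiv> gordon_term k r s"
abbreviation "G \<equiv> gordon_series k r s"

lemma r_power_neq_one: "n > 0 \<Longrightarrow> r ^ n \<noteq> 1"
  using power_neq_one[OF r1] .

section \<open>Estimates uniform in the parameters\<close>

lemma gordon_coeff_ratio_le:
  assumes "norm w \<le> 1" "norm Y \<le> 1"
  shows "norm (- (w * Y ^ k * s ^ n * r ^ (k * (2 * n + 1) + n + 1)) * (1 - Y * r ^ n) / (1 - r ^ Suc n))
     \<le> norm w * (norm r ^ n * (2 / (1 - norm r)))"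
proof -
  have "norm (1 - Y * r ^ n) \<le> norm (1 :: complex) + norm (Y * r ^ n)"
    by (rule norm_triangle_ineq4)
  moreover have "norm (Y * r ^ n) \<le> 1"
    using assms r1 by (auto simp: norm_mult norm_power intro!: mult_le_one power_le_one)
  ultimately have 1: "norm (1 - Y * r ^ n) \<le> 2" by simp
  have "norm (1::complex) - norm (r ^ Suc n) \<le> norm (1 - r ^ Suc n)"
    by (rule norm_triangle_ineq2)
  moreover have "norm (r ^ Suc n) \<le> norm r"
    using r1 by (simp add: norm_mult norm_power mult_left_le power_le_one)
  ultimately have 2: "1 - norm r \<le> norm (1 - r ^ Suc n)" by simp
  have 3: "norm (1 - Y * r ^ n) / norm (1 - r ^ Suc n) \<le> 2 / (1 - norm r)"
    using 1 2 r1 by (intro frac_le) auto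
  have "norm Y ^ k * norm s ^ n \<le> 1"
    using assms s1 by (intro mult_le_one power_le_one) auto
  moreover have "norm r ^ (k * (2 * n + 1) + n + 1) \<le> norm r ^ n"
    using r1 by (intro power_decreasing) auto
  ultimately have 4: "norm Y ^ k * norm s ^ n * norm r ^ (k * (2 * n + 1) + n + 1) \<le> 1 * norm r ^ n"
    by (intro mult_mono) auto
  have "norm (- (w * Y ^ k * s ^ n * r ^ (k * (2 * n + 1) + n + 1)) * (1 - Y * r ^ n) / (1 - r ^ Suc n))
     = norm w * ((norm Y ^ k * norm s ^ n * norm r ^ (k * (2 * n + 1) + n + 1)) *
          (norm (1 - Y * r ^ n) / norm (1 - r ^ Suc n)))"
    by (simp only: norm_mult norm_divide norm_power norm_minus_cancel) (simp only: mult_ac times_divide_eq_right times_divide_eq_left)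
  also have "\<dots> \<le> norm w * ((1 * norm r ^ n) * (2 / (1 - norm r)))"
    using r1 by (intro mult_left_mono mult_mono[OF 4 3]) auto
  finally show ?thesis by simp
qed

text \<open>Free of \<open>w\<close> and \<open>Y\<close>, hence valid on all levels at once. It is
  \<open>norm r ^ (n choose 2)\<close> times a geometric factor, which absorbs the growth of the
  powers of \<open>inverse r\<close>.\<close>

definition majorant :: "nat \<Rightarrow> real" where
  "majorant n = (\<Prod>i<n. norm r ^ i * (2 / (1 - norm r)))"

lemma summable_majorant: "summable (\<lambda>n. majorant n * c ^ n)"
proof -
  have "(\<lambda>n. norm r ^ n) \<longlonglongrightarrow> 0"
    using r1 by (intro LIMSEQ_power_zero) auto
  then have "(\<lambda>n. norm r ^ n * (2 / (1 - norm r)) * c) \<longlonglongrightarrow> 0"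
    by (intro tendsto_mult_left_zero)
  then have "summable (\<lambda>n. norm (majorant n * c ^ n))"
    by (intro summable_norm_ratio_zero) (auto simp: majorant_def)
  then show ?thesis by (rule summable_norm_cancel)
qed

lemma majorant_nonneg: "majorant n \<ge> 0"
  unfolding majorant_def using r1 by (intro prod_nonneg) auto

lemma gordon_coeff_le:
  assumes "norm w \<le> 1" "norm Y \<le> 1"
  shows "norm (al w Y n) \<le> norm w ^ n * majorant n"
proof (induction n)
  case (Suc n)
  have "norm (al w Y (Suc n)) \<le> (norm w ^ n * majorant n) * (norm w * (norm r ^ n * (2 / (1 - norm r))))"
    unfolding gordon_coeff.simps norm_mult[of "al w Y n"]
    by (intro mult_mono Suc gordon_coeff_ratio_le assms) (auto simp: majorant_nonneg)
  then show ?case by (simp add: majorant_def mult_ac)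
qed (simp add: majorant_def)

text \<open>The factor \<open>norm w\<close> retained here makes the series tend to 1 as the level
  grows.\<close>

lemma gordon_coeff_le_linear: 
  assumes "norm w \<le> 1" "norm Y \<le> 1" "n > 0"
  shows "norm (al w Y n) \<le> norm w * majorant n"
proof -
  have "norm w ^ n \<le> norm w ^ 1"
    using assms by (intro power_decreasing) auto
  then show ?thesis
    using gordon_coeff_le[OF assms(1,2), of n] mult_right_mono[OF _ majorant_nonneg, of "norm w ^ n" "norm w" n]
    by simp
qed

lemma gordon_term_le:
  assumes "norm w \<le> 1"
  shows "norm (gt w Y a n) \<le>
    norm (al w Y n) * (norm (inverse r powi a) ^ n + norm (Y powi a) * norm (r powi a) ^ n)"
proof -
  have e: "(inverse r ^ n) powi a = (inverse r powi a) ^ n" "(Y * r ^ n) powi a = Y powi a * (r powi a) ^ n"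
    by (simp_all add: power_int_mult_distrib power_int_power power_int_power' mult.commute)
  have "norm (w * s ^ n) \<le> 1"
    using assms s1 by (auto simp: norm_mult norm_power intro!: mult_le_one power_le_one)
  then have "norm (w * s ^ n) * norm (Y powi a * (r powi a) ^ n) \<le> 1 * norm (Y powi a * (r powi a) ^ n)"
    by (intro mult_right_mono) auto
  then have "norm ((inverse r powi a) ^ n - w * s ^ n * (Y powi a * (r powi a) ^ n))
     \<le> norm ((inverse r powi a) ^ n) + 1 * norm (Y powi a * (r powi a) ^ n)"
    using norm_triangle_ineq4[of "(inverse r powi a) ^ n" "w * s ^ n * (Y powi a * (r powi a) ^ n)"]
    by (simp add: norm_mult)
  then show ?thesis
    unfolding gordon_term_def e norm_mult[of "al w Y n"]
    by (intro mult_left_mono) (auto simp: norm_mult norm_power)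
qed

lemma summable_gordon_majorant:
  "summable (\<lambda>n. majorant n * (norm (inverse r powi a) ^ n + C * norm (r powi a) ^ n))"
proof -
  have "(\<lambda>n. majorant n * (norm (inverse r powi a) ^ n + C * norm (r powi a) ^ n))
    = (\<lambda>n. majorant n * norm (inverse r powi a) ^ n + C * (majorant n * norm (r powi a) ^ n))"
    by (simp add: fun_eq_iff algebra_simps)
  then show ?thesis
    by (simp only:) (intro summable_add summable_mult summable_majorant)
qed

lemma summable_gordon_term:
  assumes "norm w \<le> 1" "norm Y \<le> 1"
  shows "summable (gt w Y a)"
proof (rule summable_comparison_test'[OF summable_gordon_majorant[of a "norm (Y powi a)"]])
  fix n
  have "norm w ^ n * majorant n \<le> 1 * majorant n"
    using assms by (intro mult_right_mono power_le_one majorant_nonneg) auto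
  then have "norm (al w Y n) \<le> majorant n"
    using gordon_coeff_le[OF assms, of n] by simp
  then show "norm (gt w Y a n) \<le>
     majorant n * (norm (inverse r powi a) ^ n + norm (Y powi a) * norm (r powi a) ^ n)"
    by (intro order.trans[OF gordon_term_le[OF assms(1)]] mult_right_mono) auto
qed

lemma gordon_sums:
  assumes "norm w \<le> 1" "norm Y \<le> 1"
  shows "gt w Y a sums G w Y a"
  unfolding gordon_series_def using summable_gordon_term[OF assms] by (rule summable_sums)

lemma gordon_series_near_one:
  "\<exists>C. \<forall>w Y. norm w \<le> 1 \<longrightarrow> norm Y \<le> 1 \<longrightarrow> norm (G w Y (int a) - 1) \<le> C * norm w"
proof -
  define m where "m = (\<lambda>n. majorant n * (norm (inverse r powi int a) ^ n + 1 * norm (r powi int a) ^ n))"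
  have m: "summable m" unfolding m_def by (rule summable_gordon_majorant)
  have "norm (G w Y (int a) - 1) \<le> (\<Sum>n. m n) * norm w" if wY: "norm w \<le> 1" "norm Y \<le> 1" for w Y
  proof -
    have Ya: "norm (Y powi int a) \<le> 1"
      using wY by (simp add: norm_power power_le_one)
    have "(\<lambda>n. gt w Y (int a) n - (if n = 0 then 1 else 0)) sums (G w Y (int a) - 1)"
      using sums_single[of 0 "\<lambda>_. 1::complex"] by (intro sums_diff gordon_sums wY) (simp add: eq_commute)
    moreover have "norm (gt w Y (int a) n - (if n = 0 then 1 else 0)) \<le> m n * norm w" for n
    proof (cases "n = 0")
      case True
      have "norm w * norm (Y powi int a) \<le> norm w * 1"
        using Ya by (intro mult_left_mono) auto
      then have "norm w * norm (Y powi int a) \<le> 2 * norm w"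
        using norm_ge_zero[of w] by linarith
      then show ?thesis using True by (simp add: gordon_term_def m_def majorant_def norm_mult)
    next
      case False
      then have n: "n > 0" by simp
      have "norm (gt w Y (int a) n) \<le> (norm w * majorant n) *
         (norm (inverse r powi int a) ^ n + 1 * norm (r powi int a) ^ n)"
        by (intro order.trans[OF gordon_term_le[OF wY(1)]] mult_mono gordon_coeff_le_linear wY n add_mono Ya)
           (auto simp: majorant_nonneg)
      then show ?thesis using False by (simp add: m_def mult_ac)
    qed
    ultimately have "norm (G w Y (int a) - 1) \<le> (\<Sum>n. m n * norm w)"
      using norm_suminf_le[OF _ summable_mult2[OF m], of "\<lambda>n. gt w Y (int a) n - (if n = 0 then 1 else 0)" "norm w"]
      by (simp only: sums_unique[symmetric])
    also have "\<dots> = (\<Sum>n. m n) * norm w" using m by (rule suminf_mult2[symmetric])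
    finally show ?thesis .
  qed
  then show ?thesis by blast
qed

section \<open>The second order equation and its boundary conditions\<close>

lemma gordon_coeff_Suc_mult:
  "al w Y (Suc n) * (1 - r ^ Suc n) =
     - (al w Y n * w * Y ^ k * s ^ n * r ^ (k * (2 * n + 1) + n + 1) * (1 - Y * r ^ n))"
proof -
  have "1 - r ^ Suc n \<noteq> 0" using r_power_neq_one[of "Suc n"] by auto
  then have *: "x * (y / (1 - r ^ Suc n)) * (1 - r ^ Suc n) = x * y" for x y
    by simp
  show ?thesis
    unfolding gordon_coeff.simps * by (simp only: mult_ac mult_minus_left mult_minus_right)
qed

text \<open>The parameters \<open>w * s\<close> and \<open>Y * r\<^sup>2\<close> are those of the
  next level. The two factors on the left are what the difference operator of
  \<open>gordon_term_diff\<close> produces, so index \<open>Suc n\<close> on one level meets index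
  \<open>n\<close> on the next.\<close>

lemma gordon_coeff_shift:
  "al w Y (Suc n) * ((1 - r ^ Suc n) * (1 - Y * r ^ Suc n)) =
     - (al (w * s) (Y * r\<^sup>2) n * (w * Y ^ k * (1 - Y) * (1 - Y * r)) * r ^ (k + Suc n))"
proof (induction n)
  case 0
  show ?case
    unfolding mult.assoc[symmetric] gordon_coeff_Suc_mult by (simp add: algebra_simps)
next
  case (Suc n)
  let ?c = "w * Y ^ k * (1 - Y) * (1 - Y * r)"
  let ?X = "al (w * s) (Y * r\<^sup>2)"
  let ?e = "k * (2 * Suc n + 1) + Suc n + 1"
  have nz: "1 - r ^ Suc n \<noteq> 0" using r_power_neq_one[of "Suc n"] by auto
  have "?X (Suc n) * (1 - r ^ Suc n) =
      - (?X n * (w * s) * (Y * r\<^sup>2) ^ k * s ^ n * r ^ (k * (2 * n + 1) + n + 1) * (1 - Y * r\<^sup>2 * r ^ n))"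
    by (rule gordon_coeff_Suc_mult)
  also have "\<dots> = - (?X n * (w * Y ^ k * s ^ Suc n * (1 - Y * r ^ Suc (Suc n))) * r ^ (2 * k + (k * (2 * n + 1) + n + 1)))"
  proof -
    have e: "(Y * r\<^sup>2) ^ k = Y ^ k * r ^ (2 * k)" "Y * r\<^sup>2 * r ^ n = Y * r ^ Suc (Suc n)"
      by (simp only: power_mult_distrib power_mult) (simp add: power2_eq_square)
    show ?thesis unfolding e power_add[of r "2 * k"] power_Suc[of s] by (simp only: mult_ac)
  qed
  finally have X: "?X (Suc n) * (1 - r ^ Suc n) =
     - (?X n * (w * Y ^ k * s ^ Suc n * (1 - Y * r ^ Suc (Suc n))) * r ^ (2 * k + (k * (2 * n + 1) + n + 1)))" .
  \<comment> \<open>The extra factor \<open>1 - r ^ Suc n\<close> makes both the induction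
    hypothesis and the recursion of \<open>?X\<close> applicable; it is cancelled at the
    end.\<close>
  have "al w Y (Suc (Suc n)) * ((1 - r ^ Suc (Suc n)) * (1 - Y * r ^ Suc (Suc n))) * (1 - r ^ Suc n)
    = - (al w Y (Suc n) * ((1 - r ^ Suc n) * (1 - Y * r ^ Suc n)) *
         (w * Y ^ k * s ^ Suc n * (1 - Y * r ^ Suc (Suc n)) * r ^ ?e))"
    unfolding mult.assoc[symmetric] gordon_coeff_Suc_mult[of w Y "Suc n"]
    by (simp only: mult_ac mult_minus_left mult_minus_right)
  also have "\<dots> = ?X n * (w * Y ^ k * s ^ Suc n * (1 - Y * r ^ Suc (Suc n))) * ?c * (r ^ (k + Suc n) * r ^ ?e)"
    unfolding Suc by (simp only: mult_ac mult_minus_left mult_minus_right minus_minus)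
  also have "r ^ (k + Suc n) * r ^ ?e = r ^ (2 * k + (k * (2 * n + 1) + n + 1)) * r ^ (k + Suc (Suc n))"
    unfolding power_add[symmetric] by (simp add: algebra_simps)
  also have "?X n * (w * Y ^ k * s ^ Suc n * (1 - Y * r ^ Suc (Suc n))) * ?c * \<dots>
     = - (?X (Suc n) * (1 - r ^ Suc n)) * (?c * r ^ (k + Suc (Suc n)))"
    unfolding X by (simp only: mult_ac minus_minus)
  also have "\<dots> = - (?X (Suc n) * ?c * r ^ (k + Suc (Suc n))) * (1 - r ^ Suc n)"
    by (simp only: mult_ac mult_minus_left mult_minus_right)
  finally show ?case by (rule mult_right_cancel[OF nz, THEN iffD1])
qed

text \<open>With \<open>u = r ^ n\<close>, the exponentials \<open>u powi (- a)\<close> and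
  \<open>(Y * u) powi a\<close> are eigenfunctions of the operator on the left with the common
  eigenvalue \<open>- (1 - u) * (1 - Y * u) / u\<close>.\<close>

lemma gordon_term_diff:
  assumes "Y \<noteq> 0"
  shows "Y * (gt w Y a n - gt w Y (a - 1) n) - (gt w Y (a + 1) n - gt w Y a n)
     = - (al w Y n * ((1 - r ^ n) * (1 - Y * r ^ n)) * inverse r ^ n *
         ((inverse r ^ n) powi a - w * s ^ n * (Y * r ^ n) powi a))"
proof -
  define u where "u = r ^ n"
  have u: "u \<noteq> 0" "inverse r ^ n = inverse u" using r0 by (auto simp: u_def power_inverse)
  define A B where "A = inverse u powi a" and "B = (Y * u) powi a"
  have p: "inverse u powi (a - 1) = A * u" "inverse u powi (a + 1) = A * inverse u"
      "(Y * u) powi (a - 1) = B / (Y * u)" "(Y * u) powi (a + 1) = B * (Y * u)"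
    using u assms by (simp_all add: A_def B_def power_int_diff power_int_add divide_inverse)
  show ?thesis
    unfolding gordon_term_def u(2) u_def[symmetric] p A_def[symmetric] B_def[symmetric]
    using u(1) assms by (simp add: field_simps)
qed

text \<open>The eigenvalue vanishes for \<open>n = 0\<close>, so the series effectively starts at
  \<open>n = 1\<close>; shifting the index and applying \<open>gordon_coeff_shift\<close> yields the
  series of the next level.\<close>

lemma gordon_series_recurrence:
  assumes w: "norm w \<le> 1" "norm Y \<le> 1" "Y \<noteq> 0" and a: "a \<le> k"
  shows "Y * (G w Y (int a) - G w Y (int a - 1)) - (G w Y (int a + 1) - G w Y (int a))
     = w * Y ^ a * (1 - Y) * (1 - Y * r) * (Y * r) ^ (k - a) * G (w * s) (Y * r\<^sup>2) (int a)"
proof -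
  let ?l = "\<lambda>n. Y * (gt w Y (int a) n - gt w Y (int a - 1) n) - (gt w Y (int a + 1) n - gt w Y (int a) n)"
  let ?c = "w * Y ^ a * (1 - Y) * (1 - Y * r) * (Y * r) ^ (k - a)"
  have L: "?l sums (Y * (G w Y (int a) - G w Y (int a - 1)) - (G w Y (int a + 1) - G w Y (int a)))"
    by (intro sums_diff sums_mult gordon_sums w)
  have w': "norm (w * s) \<le> 1" "norm (Y * r\<^sup>2) \<le> 1"
    using w s1 r1 by (auto simp: norm_mult norm_power intro!: mult_le_one power_le_one)
  have R: "(\<lambda>n. ?c * gt (w * s) (Y * r\<^sup>2) (int a) n) sums (?c * G (w * s) (Y * r\<^sup>2) (int a))"
    by (intro sums_mult gordon_sums w')
  have "?l (Suc n) = ?c * gt (w * s) (Y * r\<^sup>2) (int a) n" for n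
  proof -
    have Y: "Y ^ k = Y ^ a * Y ^ (k - a)" "r ^ k = r ^ a * r ^ (k - a)"
      using a by (simp_all add: power_add[symmetric])
    have rr: "r ^ Suc n * inverse r ^ Suc n = 1"
      using r0 by (simp add: power_mult_distrib[symmetric] del: power_Suc)
    have ra: "r ^ a * inverse r ^ a = 1"
      using r0 by (simp add: power_mult_distrib[symmetric])
    have "?l (Suc n) = al (w * s) (Y * r\<^sup>2) n * (w * Y ^ k * (1 - Y) * (1 - Y * r)) * r ^ k *
       ((inverse r ^ Suc n) ^ a - w * s ^ Suc n * (Y * r ^ Suc n) ^ a) * (r ^ Suc n * inverse r ^ Suc n)"
      unfolding gordon_term_diff[OF w(3)] gordon_coeff_shift power_int_of_nat power_add[of r k]
      by (simp only: mult_ac mult_minus_left mult_minus_right minus_minus)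
    also have "\<dots> = al (w * s) (Y * r\<^sup>2) n * ?c *
        (r ^ a * ((inverse r ^ Suc n) ^ a - w * s ^ Suc n * (Y * r ^ Suc n) ^ a))"
      unfolding rr Y power_mult_distrib[of Y r "k - a"] by (simp only: mult_ac mult_1_left mult_1_right)
    also have "r ^ a * ((inverse r ^ Suc n) ^ a - w * s ^ Suc n * (Y * r ^ Suc n) ^ a)
       = (r ^ a * inverse r ^ a) * (inverse r ^ n) ^ a - (w * s) * s ^ n * ((Y * r\<^sup>2) * r ^ n) ^ a"
      by (simp add: power_mult_distrib power2_eq_square algebra_simps)
    finally show ?thesis
      unfolding ra gordon_term_def power_int_of_nat by (simp only: mult_ac mult_1_left mult_1_right)
  qed
  moreover have "?l 0 = 0"
    unfolding gordon_term_diff[OF w(3)] by simp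
  ultimately have "?l sums (?c * G (w * s) (Y * r\<^sup>2) (int a))"
    using R sums_Suc_iff[of ?l] by simp
  then show ?thesis using L sums_unique2 by blast
qed

text \<open>The second half of each term cancels against the first half of the next one.\<close>
lemma gordon_series_top:
  assumes w: "norm w \<le> 1" "norm Y \<le> 1"
  shows "G w Y (int k + 1) = G w Y (int k)"
proof -
  define v where "v n = al w Y n * w * s ^ n * (Y * r ^ n) ^ k * (1 - Y * r ^ n)" for n
  define u where "u n = al w Y n * (inverse r ^ n) ^ k * (inverse r ^ n - 1)" for n
  have uv: "u (Suc n) = - v n" for n
  proof -
    have i: "inverse r ^ Suc n - 1 = (1 - r ^ Suc n) * inverse r ^ Suc n"
      using r0 by (simp add: field_simps)
    have e: "r ^ (k * (2 * n + 1) + n + 1) * inverse r ^ (Suc n * k + Suc n) = r ^ (n * k)"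
    proof -
      have "k * (2 * n + 1) + n + 1 = n * k + (Suc n * k + Suc n)" by (simp add: algebra_simps)
      then have "r ^ (k * (2 * n + 1) + n + 1) * inverse r ^ (Suc n * k + Suc n)
          = r ^ (n * k) * (r ^ (Suc n * k + Suc n) * inverse r ^ (Suc n * k + Suc n))"
        by (simp only: power_add mult.assoc)
      also have "r ^ (Suc n * k + Suc n) * inverse r ^ (Suc n * k + Suc n) = 1"
        using r0 by (simp add: power_mult_distrib[symmetric] del: power_Suc)
      finally show ?thesis by simp
    qed
    have "u (Suc n) = al w Y (Suc n) * (1 - r ^ Suc n) * inverse r ^ (Suc n * k + Suc n)"
      unfolding u_def i power_add power_mult by (simp only: mult_ac)
    also have "\<dots> = - (al w Y n * w * Y ^ k * s ^ n * (1 - Y * r ^ n) *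
          (r ^ (k * (2 * n + 1) + n + 1) * inverse r ^ (Suc n * k + Suc n)))"
      unfolding gordon_coeff_Suc_mult by (simp only: mult_ac mult_minus_left mult_minus_right)
    also have "\<dots> = - v n"
      unfolding e v_def power_mult_distrib power_mult by (simp only: mult_ac)
    finally show ?thesis .
  qed
  have gt: "gt w Y (int k + 1) n - gt w Y (int k) n = u n + v n" for n
  proof -
    have e: "int k + 1 = int (Suc k)" by simp
    show ?thesis unfolding gordon_term_def u_def v_def e power_int_of_nat
      by (simp add: algebra_simps)
  qed
  have S: "(\<lambda>n. u n + v n) sums (G w Y (int k + 1) - G w Y (int k))"
    unfolding gt[symmetric] by (intro sums_diff gordon_sums w)
  have part: "(\<Sum>i<n. u i + v i) = - u n" for n
  proof (induction n)
    case (Suc n)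
    then show ?case using uv[of n] by simp
  qed (simp add: u_def)
  have "summable u"
  proof -
    have "u = (\<lambda>n. al w Y n * (inverse r ^ Suc k) ^ n - al w Y n * (inverse r ^ k) ^ n)"
      by (rule ext) (simp add: u_def algebra_simps power_mult_distrib power_mult[symmetric])
    moreover have "summable (\<lambda>n. al w Y n * c ^ n)" for c
    proof (rule summable_comparison_test'[OF summable_majorant[of "norm c"]])
      fix n
      have "norm w ^ n * majorant n \<le> 1 * majorant n"
        using w by (intro mult_right_mono power_le_one majorant_nonneg) auto
      then have "norm (al w Y n) \<le> majorant n"
        using gordon_coeff_le[OF w, of n] by simp
      then show "norm (al w Y n * c ^ n) \<le> majorant n * norm c ^ n"
        by (simp add: norm_mult norm_power mult_right_mono)
    qed
    ultimately show ?thesis by (simp only:) (intro summable_diff)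
  qed
  then have "u \<longlonglongrightarrow> 0" by (rule summable_LIMSEQ_zero)
  then have "(\<lambda>n. u n + v n) sums (- 0)"
    unfolding sums_def part by (rule tendsto_minus)
  then have "G w Y (int k + 1) - G w Y (int k) = 0"
    using S sums_unique2 by fastforce
  then show ?thesis by simp
qed

text \<open>This reconciles the first block of rows, with geometric sum proportional to
  \<open>1 - w\<close>, with the later ones, proportional to \<open>1 - Y\<close>. In either case
  for \<open>e\<close> the difference of the terms at \<open>0\<close> and \<open>-1\<close> is a
  multiple of the term at \<open>0\<close> with a factor independent of \<open>n\<close>.\<close>

lemma gordon_series_bottom:
  assumes w: "norm w \<le> 1" "norm Y \<le> 1" "Y \<noteq> 0"
    and e: "(w = Y \<and> s = r\<^sup>2) \<or> (Y = w\<^sup>2 \<and> s = r)"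
  shows "w * (1 - Y) * G w Y 0 = (1 - w) * Y * (G w Y 0 - G w Y (-1))"
proof -
  have "w * (1 - Y) * gt w Y 0 n = (1 - w) * Y * (gt w Y 0 n - gt w Y (-1) n)" for n
  proof -
    define u where "u = r ^ n"
    have u: "u \<noteq> 0" "inverse r ^ n = inverse u" using r0 by (auto simp: u_def power_inverse)
    from e show ?thesis
    proof
      assume *: "w = Y \<and> s = r\<^sup>2"
      then have s: "s ^ n = u * u" by (simp add: u_def power_mult_distrib[symmetric] power2_eq_square)
      show ?thesis unfolding gordon_term_def u(2) s u_def[symmetric]
        using * u(1) w(3) by (simp add: power_int_minus field_simps)
    next
      assume *: "Y = w\<^sup>2 \<and> s = r"
      then have s: "s ^ n = u" "w \<noteq> 0" using w(3) by (auto simp: u_def)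
      show ?thesis unfolding gordon_term_def u(2) s u_def[symmetric]
        using * u(1) s(2) by (simp add: power_int_minus field_simps power2_eq_square)
    qed
  qed
  moreover have "(\<lambda>n. w * (1 - Y) * gt w Y 0 n) sums (w * (1 - Y) * G w Y 0)"
    by (intro sums_mult gordon_sums w)
  moreover have "(\<lambda>n. (1 - w) * Y * (gt w Y 0 n - gt w Y (-1) n)) sums ((1 - w) * Y * (G w Y 0 - G w Y (-1)))"
    by (intro sums_mult sums_diff gordon_sums w)
  ultimately show ?thesis using sums_unique2 by (simp only:)
qed

end

section \<open>Generating functions of restricted partitions\<close>

text \<open>The bound \<open>A\<close> restricts the smallest part allowed on level
  \<open>N\<close>, and \<open>L\<close> counts the pairs of an odd and an even part that
  remain.\<close>

definition admissible :: "nat \<Rightarrow> nat \<Rightarrow> nat \<Rightarrow> nat \<Rightarrow> nat \<Rightarrow> (nat \<Rightarrow> nat) set" where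
  "admissible d K N L A = {phi. (\<forall>i. phi i \<noteq> 0 \<longrightarrow> 2 * N < i \<and> i \<le> 2 * (N + L)) \<and>
      (\<forall>i\<ge>1. phi i + phi (i + 1) < K) \<and> phi (2 * N + 1) < A \<and> (\<forall>i\<ge>1. d dvd phi (2 * i))}"

definition size_upto :: "nat \<Rightarrow> (nat \<Rightarrow> nat) \<Rightarrow> nat" where
  "size_upto b phi = (\<Sum>i=1..b. i * phi i)"

text \<open>The type is left open because both the complex \<open>q\<close> and the real
  \<open>norm q\<close> are substituted; the real value serves as a majorant.\<close>

definition genfun :: "nat \<Rightarrow> nat \<Rightarrow> 'a :: comm_semiring_1 \<Rightarrow> nat \<Rightarrow> nat \<Rightarrow> nat \<Rightarrow> 'a" where
  "genfun d K q N L A = (\<Sum>phi\<in>admissible d K N L A. q ^ size_upto (2 * (N + L)) phi)"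

text \<open>The possible multiplicities \<open>j\<close> and \<open>d m\<close> of the two smallest parts.\<close>
definition initial_pairs :: "nat \<Rightarrow> nat \<Rightarrow> nat \<Rightarrow> (nat \<times> nat) set" where
  "initial_pairs d K A = {(j, m). j < A \<and> j + d * m < K}"

lemma finite_admissible: "finite (admissible d K N L A)"
proof (rule finite_subset)
  show "admissible d K N L A \<subseteq>
     {phi. \<forall>i. (i \<in> {..2 * (N + L)} \<longrightarrow> phi i \<in> {..K}) \<and> (i \<notin> {..2 * (N + L)} \<longrightarrow> phi i = 0)}"
  proof (intro subsetI CollectI allI)
    fix phi i assume phi: "phi \<in> admissible d K N L A"
    have supp: "phi i = 0 \<or> 2 * N < i \<and> i \<le> 2 * (N + L)"
      using phi unfolding admissible_def by blast
    have "phi i \<le> K"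
    proof (cases "i \<ge> 1")
      case True
      then have "phi i + phi (i + 1) < K" using phi by (simp add: admissible_def)
      then show ?thesis by simp
    next
      case False
      then show ?thesis using supp by simp
    qed
    then show "(i \<in> {..2 * (N + L)} \<longrightarrow> phi i \<in> {..K}) \<and> (i \<notin> {..2 * (N + L)} \<longrightarrow> phi i = 0)"
      using supp by auto
  qed
qed (rule finite_set_of_finite_funs, auto)

lemma finite_initial_pairs:
  assumes "d \<ge> 1"
  shows "initial_pairs d K A \<subseteq> {..<K} \<times> {..<K}" "finite (initial_pairs d K A)"
proof -
  show *: "initial_pairs d K A \<subseteq> {..<K} \<times> {..<K}"
  proof (rule subrelI)
    fix j m assume "(j, m) \<in> initial_pairs d K A"
    then have "j + d * m < K" by (simp add: initial_pairs_def)
    moreover have "m \<le> d * m" using assms by simp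
    ultimately have "j < K" "m < K" by linarith+
    then show "(j, m) \<in> {..<K} \<times> {..<K}" by simp
  qed
  show "finite (initial_pairs d K A)" by (rule finite_subset[OF *]) auto
qed

lemma size_upto_upd:
  assumes "phi a = 0" "1 \<le> a" "a \<le> b"
  shows "size_upto b (phi(a := x)) = a * x + size_upto b phi"
proof -
  have "size_upto b (phi(a := x)) = (\<Sum>i=1..b. i * phi i + (if i = a then a * x else 0))"
    unfolding size_upto_def using assms by (intro sum.cong) auto
  also have "\<dots> = size_upto b phi + a * x"
    unfolding size_upto_def using assms by (simp add: sum.distrib)
  finally show ?thesis by simp
qed

lemma admissible_0:
  assumes "A \<ge> 1" "K \<ge> 1"
  shows "admissible d K N 0 A = {\<lambda>_. 0}"
  using assms by (fastforce simp: admissible_def)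

lemma genfun_0:
  assumes "A \<ge> 1" "K \<ge> 1"
  shows "genfun d K q N 0 A = 1"
  by (simp add: admissible_0[OF assms] genfun_def size_upto_def)

text \<open>Deleting the two smallest parts is a bijection. The condition on the multiplicities of
  \<open>2 * N + 2\<close> and \<open>2 * N + 3\<close> survives as the new bound
  \<open>K - d * m\<close>.\<close>

lemma genfun_Suc:
  fixes q :: "'a :: comm_semiring_1"
  assumes d: "d \<ge> 1"
  shows "genfun d K q N (Suc L) A = (\<Sum>(j, m)\<in>initial_pairs d K A.
    q ^ ((2 * N + 1) * j + (2 * N + 2) * (d * m)) * genfun d K q (Suc N) L (K - d * m))"
proof -
  let ?b = "2 * (N + Suc L)"
  let ?S = "SIGMA p:initial_pairs d K A. admissible d K (Suc N) L (K - d * snd p)"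
  let ?up = "\<lambda>(p, psi). (psi :: nat \<Rightarrow> nat)(2 * N + 1 := fst p, 2 * N + 2 := d * snd p)"
  let ?down = "\<lambda>phi. ((phi (2 * N + 1), phi (2 * N + 2) div d), phi(2 * N + 1 := 0, 2 * N + 2 := 0))"
  have "(\<Sum>(j, m)\<in>initial_pairs d K A.
      q ^ ((2 * N + 1) * j + (2 * N + 2) * (d * m)) * genfun d K q (Suc N) L (K - d * m))
    = (\<Sum>(p, psi)\<in>?S. q ^ ((2 * N + 1) * fst p + (2 * N + 2) * (d * snd p)) * q ^ size_upto ?b psi)"
    unfolding genfun_def sum_distrib_left case_prod_unfold
    by (subst sum.Sigma)
       (auto simp: finite_initial_pairs[OF d] finite_admissible case_prod_unfold)
  also have "\<dots> = (\<Sum>phi\<in>admissible d K N (Suc L) A. q ^ size_upto ?b phi)"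
  proof (rule sum.reindex_bij_witness[of _ ?down ?up])
    fix x assume "x \<in> ?S"
    then obtain j m psi where x: "x = ((j, m), psi)" and j: "j < A" "j + d * m < K"
      and psi: "psi \<in> admissible d K (Suc N) L (K - d * m)"
      by (auto simp: initial_pairs_def)
    have supp: "psi i \<noteq> 0 \<Longrightarrow> 2 * N + 2 < i \<and> i \<le> ?b" for i
      using psi by (auto simp: admissible_def)
    have z: "psi i = 0" if "i \<le> 2 * N + 2" for i using supp[of i] that by fastforce
    show "?down (?up x) = x"
      using d z by (auto simp: x)
    let ?phi = "psi(2 * N + 1 := j, 2 * N + 2 := d * m)"
    have "?phi i + ?phi (i + 1) < K" if "i \<ge> 1" for i
    proof -
      consider "i < 2 * N" | "i = 2 * N" | "i = 2 * N + 1" | "i = 2 * N + 2" | "i > 2 * N + 2"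
        by linarith
      then show ?thesis
      proof cases
        case 1
        then show ?thesis using z[of i] z[of "i + 1"] j by simp
      next
        case 2
        then show ?thesis using z[of i] j by simp
      next
        case 3
        then show ?thesis using j by simp
      next
        case 4
        have "psi (2 * Suc N + 1) < K - d * m" using psi by (simp add: admissible_def)
        then show ?thesis using 4 by simp
      next
        case 5
        then show ?thesis using psi that by (simp add: admissible_def)
      qed
    qed
    moreover have "d dvd ?phi (2 * i)" if "i \<ge> 1" for i
    proof (cases "i = Suc N")
      case False
      then have "?phi (2 * i) = psi (2 * i)" by auto
      then show ?thesis using psi that by (simp add: admissible_def)
    qed auto
    moreover have "?phi i \<noteq> 0 \<longrightarrow> 2 * N < i \<and> i \<le> ?b" for i
      using supp[of i] by auto
    moreover have "?phi (2 * N + 1) < A" using j by simp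
    ultimately have "?phi \<in> admissible d K N (Suc L) A"
      unfolding admissible_def by blast
    then show "?up x \<in> admissible d K N (Suc L) A"
      by (simp only: x prod.case fst_conv snd_conv)
    show "q ^ size_upto ?b (?up x) = (case x of (p, psi) \<Rightarrow>
        q ^ ((2 * N + 1) * fst p + (2 * N + 2) * (d * snd p)) * q ^ size_upto ?b psi)"
    proof -
      have "size_upto ?b ?phi = (2 * N + 2) * (d * m) + size_upto ?b (psi(2 * N + 1 := j))"
        using z by (intro size_upto_upd) auto
      also have "size_upto ?b (psi(2 * N + 1 := j)) = (2 * N + 1) * j + size_upto ?b psi"
        using z by (intro size_upto_upd) auto
      finally have E: "size_upto ?b ?phi = (2 * N + 2) * (d * m) + ((2 * N + 1) * j + size_upto ?b psi)" .
      show ?thesis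
        unfolding x prod.case fst_conv snd_conv E power_add by (rule mult.left_commute[THEN trans]) (rule mult.assoc[symmetric])
    qed
  next
    fix phi assume phi: "phi \<in> admissible d K N (Suc L) A"
    have dv: "d dvd phi (2 * N + 2)"
    proof -
      have "\<forall>i\<ge>1. d dvd phi (2 * i)" using phi unfolding admissible_def by blast
      from this[rule_format, of "Suc N"] show ?thesis by simp
    qed
    then show "?up (?down phi) = phi" by auto
    have bd: "phi i + phi (i + 1) < K" if "i \<ge> 1" for i
      using phi that unfolding admissible_def by blast
    have supp: "phi i \<noteq> 0 \<longrightarrow> 2 * N < i \<and> i \<le> ?b" for i
      using phi unfolding admissible_def by blast
    let ?psi = "phi(2 * N + 1 := 0, 2 * N + 2 := 0)"
    have "(phi (2 * N + 1), phi (2 * N + 2) div d) \<in> initial_pairs d K A"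
      using bd[of "2 * N + 1"] dv phi by (auto simp: initial_pairs_def admissible_def)
    moreover have "?psi \<in> admissible d K (Suc N) L (K - d * (phi (2 * N + 2) div d))"
    proof -
      have "?psi i + ?psi (i + 1) < K" if "i \<ge> 1" for i
        using bd[OF that] by auto
      moreover have "d dvd ?psi (2 * i)" if "i \<ge> 1" for i
        using phi that by (auto simp: admissible_def)
      moreover have "?psi i \<noteq> 0 \<longrightarrow> 2 * Suc N < i \<and> i \<le> 2 * (Suc N + L)" for i
        using supp[of i] by (auto simp: fun_upd_def)
      moreover have "?psi (2 * Suc N + 1) < K - d * (phi (2 * N + 2) div d)"
        using bd[of "2 * N + 2"] dv by simp
      ultimately show ?thesis unfolding admissible_def by blast
    qed
    ultimately show "?down phi \<in> ?S" by simp
  qed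
  finally show ?thesis by (simp add: genfun_def)
qed

text \<open>At each level the pair \<open>(0, 0)\<close> has weight 1, and every other one of the at
  most \<open>K * K\<close> pairs has weight at most \<open>t ^ (2 * N + 1)\<close>.\<close>

lemma genfun_le_prod:
  fixes t :: real
  assumes "d \<ge> 1" "K \<ge> 1" "A \<ge> 1" "0 \<le> t" "t \<le> 1"
  shows "genfun d K t N L A \<le> (\<Prod>i<L. 1 + real (K * K) * t ^ (2 * (N + i) + 1))"
  using assms(3)
proof (induction L arbitrary: N A)
  case 0
  then show ?case by (simp add: genfun_0[OF 0 assms(2)])
next
  case (Suc L)
  let ?B = "\<Prod>i<L. 1 + real (K * K) * t ^ (2 * (Suc N + i) + 1)"
  let ?c = "\<lambda>(j, m). t ^ ((2 * N + 1) * j + (2 * N + 2) * (d * m))"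
  let ?R = "initial_pairs d K A"
  note fin = finite_initial_pairs[OF assms(1), of K A]
  have B: "?B \<ge> 0" using assms by (intro prod_nonneg) auto
  have "genfun d K t N (Suc L) A \<le> (\<Sum>p\<in>?R. ?c p * ?B)"
    unfolding genfun_Suc[OF assms(1)]
  proof (intro sum_mono)
    fix p assume p: "p \<in> ?R"
    obtain j m where jm: "p = (j, m)" by (cases p)
    have "genfun d K t (Suc N) L (K - d * m) \<le> ?B"
      using p by (intro Suc.IH) (auto simp: jm initial_pairs_def)
    then show "(case p of (j, m) \<Rightarrow> t ^ ((2 * N + 1) * j + (2 * N + 2) * (d * m)) *
        genfun d K t (Suc N) L (K - d * m)) \<le> ?c p * ?B"
      unfolding jm prod.case using assms by (intro mult_left_mono) auto
  qed
  also have "\<dots> = (\<Sum>p\<in>?R. ?c p) * ?B" by (simp add: sum_distrib_right)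
  also have "(\<Sum>p\<in>?R. ?c p) \<le> (\<Sum>p\<in>?R. (if p = (0,0) then 1 else 0) + t ^ (2 * N + 1))"
  proof (intro sum_mono)
    fix p assume "p \<in> ?R"
    obtain j m where p: "p = (j, m)" by (cases p)
    show "?c p \<le> (if p = (0,0) then 1 else 0) + t ^ (2 * N + 1)"
    proof (cases "p = (0,0)")
      case True
      then show ?thesis using assms by simp
    next
      case False
      have "2 * N + 1 \<le> (2 * N + 1) * j + (2 * N + 2) * (d * m)"
      proof (cases "j = 0")
        case True
        then have "d * m \<ge> 1" using False p assms(1) by (simp add: Suc_le_eq)
        then have "(2 * N + 2) * 1 \<le> (2 * N + 2) * (d * m)" by (intro mult_le_mono2)
        then show ?thesis unfolding mult_1_right by (intro trans_le_add2) simp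
      next
        case False
        then have "(2 * N + 1) * 1 \<le> (2 * N + 1) * j" by (intro mult_le_mono2) simp
        then show ?thesis unfolding mult_1_right by (rule trans_le_add1)
      qed
      then have "t ^ ((2 * N + 1) * j + (2 * N + 2) * (d * m)) \<le> t ^ (2 * N + 1)"
        using assms by (intro power_decreasing) auto
      then show ?thesis using False unfolding p by (simp only: prod.case if_False add_0_left)
    qed
  qed
  also have "\<dots> \<le> 1 + real (K * K) * t ^ (2 * N + 1)"
  proof -
    have "card ?R \<le> K * K"
      using card_mono[OF _ fin(1)] by simp
    then have "real (card ?R) * t ^ (2 * N + 1) \<le> real (K * K) * t ^ (2 * N + 1)"
      using assms by (intro mult_right_mono of_nat_mono) auto
    moreover have "(\<Sum>p\<in>?R. if p = (0,0) then 1 else 0) \<le> (1::real)"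
      using fin(2) by simp
    ultimately show ?thesis by (simp add: sum.distrib)
  qed
  finally have "genfun d K t N (Suc L) A \<le> (1 + real (K * K) * t ^ (2 * N + 1)) * ?B"
    using B by (simp add: mult_right_mono)
  then show ?case by (simp add: prod.lessThan_Suc_shift del: prod.lessThan_Suc)
qed

lemma genfun_bounded:
  fixes t :: real
  assumes "d \<ge> 1" "K \<ge> 1" "A \<ge> 1" "0 \<le> t" "t < 1"
  obtains C where "\<And>L. genfun d K t N L A \<le> C"
proof
  fix L
  have "genfun d K t N L A \<le> (\<Prod>i<L. 1 + real (K * K) * t ^ (2 * (N + i) + 1))"
    using assms by (intro genfun_le_prod) auto
  also have "\<dots> \<le> exp (\<Sum>i<L. real (K * K) * t ^ (2 * (N + i) + 1))"
    using assms by (intro prod_le_exp_sum) auto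
  also have "\<dots> \<le> exp (real (K * K) * (1 / (1 - t)))"
  proof -
    have "(\<Sum>i<L. t ^ (2 * (N + i) + 1)) \<le> (\<Sum>i<L. t ^ i)"
      using assms by (intro sum_mono power_decreasing) auto
    also have "\<dots> \<le> (\<Sum>i. t ^ i)"
      using assms by (intro sum_le_suminf summable_geometric) auto
    also have "\<dots> = 1 / (1 - t)" using assms by (intro suminf_geometric) auto
    finally show ?thesis
      unfolding sum_distrib_left[symmetric] exp_le_cancel_iff by (intro mult_left_mono) auto
  qed
  finally show "genfun d K t N L A \<le> exp (real (K * K) * (1 / (1 - t)))" .
qed

section \<open>From truncated generating functions to the counting function\<close>

lemma admissible_size:
  assumes "phi \<in> admissible d K 0 L A" "size_upto (2 * L) phi = n"
  shows "is_partition_mult phi n"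
proof -
  have *: "\<forall>i. phi i \<noteq> 0 \<longrightarrow> 2 * 0 < i \<and> i \<le> 2 * (0 + L)"
    using assms(1) unfolding admissible_def by blast
  have supp: "1 \<le> i \<and> i \<le> 2 * L" if "phi i \<noteq> 0" for i
    using *[rule_format, OF that] by simp
  have supp': "i \<le> n" if "phi i \<noteq> 0" for i
  proof -
    have "i * 1 \<le> i * phi i" using that by (intro mult_le_mono2) simp
    also have "\<dots> \<le> (\<Sum>i=1..2*L. i * phi i)"
      using supp[OF that] by (intro member_le_sum) auto
    finally show ?thesis using assms(2) by (simp add: size_upto_def)
  qed
  have "(\<Sum>i=1..n. i * phi i) = (\<Sum>i=1..2*L. i * phi i)"
  proof (rule sum.mono_neutral_cong)
    show "i * phi i = 0" if "i \<in> {1..2*L} - {1..n}" for i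
      using supp'[of i] that by auto
    show "i * phi i = 0" if "i \<in> {1..n} - {1..2*L}" for i
      using supp[of i] that by auto
  qed auto
  then show ?thesis
    using supp supp' assms(2) by (auto simp: is_partition_mult_def size_upto_def)
qed

definition dB_set :: "nat \<Rightarrow> nat \<Rightarrow> nat \<Rightarrow> nat \<Rightarrow> (nat \<Rightarrow> nat) set" where
  "dB_set d K A n = {phi. is_partition_mult phi n \<and>
      (\<forall>i\<ge>1. phi i + phi (i + 1) < K) \<and> phi 1 < A \<and> (\<forall>i\<ge>1. d dvd phi (2 * i))}"

lemma admissible_subset_dB_set:
  "{phi \<in> admissible d K 0 L A. size_upto (2 * L) phi = n} \<subseteq> dB_set d K A n"
proof
  fix phi assume "phi \<in> {phi \<in> admissible d K 0 L A. size_upto (2 * L) phi = n}"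
  then have phi: "phi \<in> admissible d K 0 L A" "size_upto (2 * L) phi = n" by auto
  show "phi \<in> dB_set d K A n"
    using admissible_size[OF phi] phi(1) by (simp add: dB_set_def admissible_def)
qed

lemma admissible_eq_dB_set:
  assumes "n \<le> 2 * L"
  shows "{phi \<in> admissible d K 0 L A. size_upto (2 * L) phi = n} = dB_set d K A n"
proof
  show "dB_set d K A n \<subseteq> {phi \<in> admissible d K 0 L A. size_upto (2 * L) phi = n}"
  proof
    fix phi assume phi: "phi \<in> dB_set d K A n"
    then have supp: "1 \<le> i \<and> i \<le> n" if "phi i \<noteq> 0" for i
      using that by (auto simp: dB_set_def is_partition_mult_def)
    have "size_upto (2 * L) phi = (\<Sum>i=1..n. i * phi i)"
      unfolding size_upto_def
    proof (rule sum.mono_neutral_right)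
      show "\<forall>i\<in>{1..2*L} - {1..n}. i * phi i = 0"
        using supp by fastforce
    qed (use assms in auto)
    moreover have "\<dots> = n" using phi by (simp add: dB_set_def is_partition_mult_def)
    moreover have "phi \<in> admissible d K 0 L A"
    proof -
      have "\<forall>i. phi i \<noteq> 0 \<longrightarrow> 2 * 0 < i \<and> i \<le> 2 * (0 + L)"
        using supp assms by fastforce
      then show ?thesis using phi by (simp add: dB_set_def admissible_def)
    qed
    ultimately show "phi \<in> {phi \<in> admissible d K 0 L A. size_upto (2 * L) phi = n}" by simp
  qed
qed (rule admissible_subset_dB_set)

lemma finite_dB_set: "finite (dB_set d K A n)"
proof (rule finite_subset)
  show "dB_set d K A n \<subseteq> admissible d K 0 n A"
    using admissible_eq_dB_set[of n n d K A] by auto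
qed (rule finite_admissible)

lemma dB_eq_card: "dB d K A n = card (dB_set d K A n)"
  by (simp add: dB_def dB_set_def)

lemma genfun_sums:
  fixes q :: "'a :: {comm_semiring_1, real_normed_algebra_1}"
  shows "(\<lambda>n. of_nat (card {phi \<in> admissible d K 0 L A. size_upto (2 * L) phi = n}) * q ^ n)
      sums genfun d K q 0 L A"
proof -
  let ?S = "admissible d K 0 L A"
  let ?c = "\<lambda>n. card {phi \<in> ?S. size_upto (2 * L) phi = n}"
  let ?I = "size_upto (2 * L) ` ?S"
  have "(\<lambda>n. of_nat (?c n) * q ^ n) sums (\<Sum>n\<in>?I. of_nat (?c n) * q ^ n)"
  proof (rule sums_finite)
    fix n assume "n \<notin> ?I"
    then have "{phi \<in> ?S. size_upto (2 * L) phi = n} = {}" by auto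
    then show "of_nat (?c n) * q ^ n = 0" by (simp only: card.empty of_nat_0 mult_zero_left)
  qed (simp add: finite_admissible)
  also have "(\<Sum>n\<in>?I. of_nat (?c n) * q ^ n)
      = (\<Sum>n\<in>?I. \<Sum>phi\<in>{phi \<in> ?S. size_upto (2 * L) phi = n}. q ^ size_upto (2 * L) phi)"
    by (intro sum.cong refl) simp
  also have "\<dots> = genfun d K q 0 L A"
    unfolding genfun_def by (subst sum.group) (auto simp: finite_admissible)
  finally show ?thesis .
qed

text \<open>The truncated coefficients never exceed those of \<open>dB\<close> and equal them for
  \<open>n \<le> 2 * L\<close>. Boundedness of \<open>genfun\<close> at \<open>norm q\<close>
  therefore makes the full series absolutely summable, and that series dominates in Tannery's
  theorem.\<close>

lemma dB_sums:
  fixes q :: complex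
  assumes "d \<ge> 1" "K \<ge> 1" "A \<ge> 1" "norm q < 1"
    and V: "(\<lambda>L. genfun d K q 0 L A) \<longlonglongrightarrow> V"
  shows "(\<lambda>n. of_nat (dB d K A n) * q ^ n) sums V"
proof -
  let ?c = "\<lambda>L n. card {phi \<in> admissible d K 0 L A. size_upto (2 * L) phi = n}"
  have c_le: "?c L n \<le> dB d K A n" for L n
    unfolding dB_eq_card by (intro card_mono finite_dB_set admissible_subset_dB_set)
  have c_eq: "?c L n = dB d K A n" if "n \<le> 2 * L" for L n
    unfolding dB_eq_card admissible_eq_dB_set[OF that] ..
  obtain C where C: "\<And>L. genfun d K (norm q) 0 L A \<le> C"
    using genfun_bounded[OF assms(1-3), of "norm q" 0] assms(4) by auto
  have sm: "summable (\<lambda>n. real (dB d K A n) * norm q ^ n)"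
  proof (rule summableI_nonneg_bounded)
    fix L
    have "(\<Sum>n<L. real (dB d K A n) * norm q ^ n) = (\<Sum>n<L. real (?c L n) * norm q ^ n)"
      by (intro sum.cong refl) (simp add: c_eq)
    also have "\<dots> \<le> genfun d K (norm q) 0 L A"
      unfolding sums_unique[OF genfun_sums[of d K L A "norm q"]]
      by (intro sum_le_suminf sums_summable[OF genfun_sums]) auto
    also have "\<dots> \<le> C" by (rule C)
    finally show "(\<Sum>n<L. real (dB d K A n) * norm q ^ n) \<le> C" .
  qed auto
  let ?a = "\<lambda>n L. of_nat (?c L n) * q ^ n"
  let ?b = "\<lambda>n. of_nat (dB d K A n) * q ^ n"
  have T: "eventually (\<lambda>L. summable (\<lambda>n. norm (?a n L))) sequentially \<and> summable (\<lambda>n. norm (?b n)) \<and>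
     (\<lambda>L. \<Sum>n. ?a n L) \<longlonglongrightarrow> (\<Sum>n. ?b n)"
  proof (rule tannerys_theorem[OF _ _ sm])
    fix n
    have "eventually (\<lambda>L. ?a n L = ?b n) sequentially"
      using eventually_ge_at_top[of n] by eventually_elim (simp add: c_eq)
    then show "(\<lambda>L. ?a n L) \<longlonglongrightarrow> ?b n" by (rule tendsto_eventually)
  next
    show "eventually (\<lambda>(n, L). norm (?a n L) \<le> real (dB d K A n) * norm q ^ n) (sequentially \<times>\<^sub>F sequentially)"
    proof (rule always_eventually, rule allI)
      fix p :: "nat \<times> nat"
      obtain n L where p: "p = (n, L)" by (cases p)
      have "real (?c L n) * norm q ^ n \<le> real (dB d K A n) * norm q ^ n"
        by (intro mult_right_mono of_nat_mono c_le) simp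
      then show "case p of (n, L) \<Rightarrow> norm (?a n L) \<le> real (dB d K A n) * norm q ^ n"
        unfolding p prod.case norm_mult norm_power norm_of_nat .
    qed
  qed (rule sequentially_bot)
  have "summable ?b"
    by (rule summable_norm_cancel) (rule T[THEN conjunct2, THEN conjunct1])
  moreover have "(\<lambda>L. \<Sum>n. ?a n L) \<longlonglongrightarrow> (\<Sum>n. ?b n)"
    by (rule T[THEN conjunct2, THEN conjunct2])
  moreover have "(\<Sum>n. ?a n L) = genfun d K q 0 L A" for L
    using genfun_sums[of d K L A q] by (rule sums_unique[symmetric])
  ultimately have "(\<Sum>n. ?b n) = V"
    using V by (simp only: LIMSEQ_unique)
  then show ?thesis using summable_sums[OF \<open>summable ?b\<close>] by simp
qed

section \<open>Solution of the recurrence\<close>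

lemma sum_initial_pairs:
  fixes y :: "'a :: comm_ring_1"
  assumes "d \<ge> 1"
  shows "(\<Sum>(j, m)\<in>initial_pairs d K A. y ^ j * X m) = (\<Sum>j<A. y ^ j * (\<Sum>m | j + d * m < K. X m))"
proof -
  have fin: "finite {m. j + d * m < K}" for j
  proof (rule finite_subset)
    show "{m. j + d * m < K} \<subseteq> {..<K}"
      using finite_initial_pairs(1)[OF assms, of K "Suc j"] by (auto simp: initial_pairs_def)
  qed simp
  have "initial_pairs d K A = (SIGMA j:{..<A}. {m. j + d * m < K})"
    by (auto simp: initial_pairs_def)
  then show ?thesis
    using fin by (simp add: sum.Sigma[symmetric] sum_distrib_left)
qed

text \<open>For \<open>j < e \<le> d\<close> the condition on \<open>m\<close> is just
  \<open>m \<le> k\<close>, so the double sum factors.\<close>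

lemma sum_initial_pairs_base:
  fixes y :: "'a :: comm_ring_1"
  assumes "d \<ge> 1" "e \<le> d"
  shows "(\<Sum>(j, m)\<in>initial_pairs d (d * k + e) e. y ^ j * X m) = (\<Sum>j<e. y ^ j) * (\<Sum>m<Suc k. X m)"
proof -
  have "{m. j + d * m < d * k + e} = {..<Suc k}" if "j < e" for j
  proof (intro set_eqI iffI)
    fix m assume m: "m \<in> {m. j + d * m < d * k + e}"
    show "m \<in> {..<Suc k}"
    proof (rule ccontr)
      assume "m \<notin> {..<Suc k}"
      then have "d * Suc k \<le> d * m" by (intro mult_le_mono2) simp
      then show False using m assms by simp
    qed
  next
    fix m assume "m \<in> {..<Suc k}"
    then have "d * m \<le> d * k" by (intro mult_le_mono2) simp
    then have "j + d * m < d * k + e" using that by linarith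
    then show "m \<in> {m. j + d * m < d * k + e}" by simp
  qed
  then show ?thesis
    unfolding sum_initial_pairs[OF assms(1)] sum_distrib_right by (intro sum.cong) auto
qed

text \<open>The rows from \<open>d * a + e\<close> up to \<open>d * (a + 1) + e - 1\<close> all
  allow exactly \<open>m < k - a\<close>. Hence a bound inside such a block contributes only a
  shorter geometric sum, which later gives the interpolation.\<close>

lemma sum_initial_pairs_step:
  fixes y :: "'a :: comm_ring_1"
  assumes "d \<ge> 1" "a \<le> k" "c \<le> d"
  shows "(\<Sum>(j, m)\<in>initial_pairs d (d * k + e) (d * a + e + c). y ^ j * X m)
    = (\<Sum>(j, m)\<in>initial_pairs d (d * k + e) (d * a + e). y ^ j * X m)
      + y ^ (d * a + e) * (\<Sum>j<c. y ^ j) * (\<Sum>m<k - a. X m)"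
  using assms(3)
proof (induction c)
  case (Suc c)
  have "{m. d * a + e + c + d * m < d * k + e} = {..<k - a}"
  proof (intro set_eqI iffI)
    fix m assume m: "m \<in> {m. d * a + e + c + d * m < d * k + e}"
    show "m \<in> {..<k - a}"
    proof (rule ccontr)
      assume "m \<notin> {..<k - a}"
      then have "d * k \<le> d * (a + m)" by (intro mult_le_mono2) simp
      then show False using m by (simp add: algebra_simps)
    qed
  next
    fix m assume "m \<in> {..<k - a}"
    then have "d * (a + Suc m) \<le> d * k" by (intro mult_le_mono2) simp
    then show "m \<in> {m. d * a + e + c + d * m < d * k + e}"
      using Suc.prems by (simp add: algebra_simps)
  qed
  then have "(\<Sum>(j, m)\<in>initial_pairs d (d * k + e) (d * a + e + Suc c). y ^ j * X m)
    = (\<Sum>(j, m)\<in>initial_pairs d (d * k + e) (d * a + e + c). y ^ j * X m)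
      + y ^ (d * a + e) * y ^ c * (\<Sum>m<k - a. X m)"
    unfolding sum_initial_pairs[OF assms(1)] by (simp add: power_add)
  then show ?case using Suc by (simp add: algebra_simps)
qed simp

text \<open>
  The error at level \<open>N + L\<close> is transported down by the recurrence, whose coefficients are dominated by
  those of the positive solution at \<open>norm q\<close>.
\<close>
lemma genfun_approx:
  fixes q :: complex and H :: "nat \<Rightarrow> nat \<Rightarrow> complex"
  assumes d: "d \<ge> 1" and e: "1 \<le> e" "e \<le> d"
    and H: "\<And>N a. a \<le> k \<Longrightarrow> H N a = (\<Sum>(j, m)\<in>initial_pairs d (d * k + e) (d * a + e).
       q ^ ((2 * N + 1) * j + (2 * N + 2) * (d * m)) * H (Suc N) (k - m))"
    and eps: "\<And>a. a \<le> k \<Longrightarrow> norm (H (N + L) a - 1) \<le> eps" and a: "a \<le> k"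
  shows "norm (genfun d (d * k + e) q N L (d * a + e) - H N a)
      \<le> eps * genfun d (d * k + e) (norm q) N L (d * a + e)"
  using eps a
proof (induction L arbitrary: N a)
  case 0
  have "norm (1 - H N a) = norm (H N a - 1)" by (rule norm_minus_commute)
  then show ?case using 0 e by (simp add: genfun_0)
next
  case (Suc L)
  let ?R = "initial_pairs d (d * k + e) (d * a + e)"
  let ?x = "\<lambda>j m. (2 * N + 1) * j + (2 * N + 2) * (d * m)"
  let ?g = "\<lambda>m. genfun d (d * k + e) q (Suc N) L (d * k + e - d * m)"
  let ?h = "\<lambda>m. genfun d (d * k + e) (norm q) (Suc N) L (d * k + e - d * m)"
  have IH: "norm (?g m - H (Suc N) (k - m)) \<le> eps * ?h m" if "(j, m) \<in> ?R" for j m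
  proof -
    have "m \<le> k"
    proof (rule ccontr)
      assume "\<not> m \<le> k"
      then have "d * Suc k \<le> d * m" by (intro mult_le_mono2) simp
      moreover have "j + d * m < d * k + e" using that by (simp add: initial_pairs_def)
      ultimately show False using e by simp
    qed
    then have eq: "d * k + e - d * m = d * (k - m) + e"
      by (simp add: diff_mult_distrib2)
    show ?thesis unfolding eq using Suc.prems(1) by (intro Suc.IH) simp_all
  qed
  have "norm (genfun d (d * k + e) q N (Suc L) (d * a + e) - H N a)
     = norm (\<Sum>(j, m)\<in>?R. q ^ ?x j m * (?g m - H (Suc N) (k - m)))"
    unfolding H[OF Suc.prems(2)] genfun_Suc[OF d] sum_subtractf[symmetric]
    by (intro arg_cong[of _ _ norm] sum.cong) (auto simp: algebra_simps)
  also have "\<dots> \<le> (\<Sum>(j, m)\<in>?R. eps * (norm q ^ ?x j m * ?h m))"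
  proof (rule sum_norm_le)
    fix p assume p: "p \<in> ?R"
    obtain j m where jm: "p = (j, m)" by (cases p)
    have "norm q ^ ?x j m * norm (?g m - H (Suc N) (k - m)) \<le> norm q ^ ?x j m * (eps * ?h m)"
      using IH p by (intro mult_left_mono) (auto simp: jm)
    then show "norm (case p of (j, m) \<Rightarrow> q ^ ?x j m * (?g m - H (Suc N) (k - m)))
        \<le> (case p of (j, m) \<Rightarrow> eps * (norm q ^ ?x j m * ?h m))"
      unfolding jm prod.case norm_mult norm_power mult.left_commute[of eps] .
  qed
  also have "\<dots> = eps * genfun d (d * k + e) (norm q) N (Suc L) (d * a + e)"
    unfolding genfun_Suc[OF d] sum_distrib_left by (intro sum.cong) auto
  finally show ?case .
qed

text \<open>The uniqueness principle: a solution of the recurrence that tends to 1 is the limit of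
  the truncated generating functions.\<close>

lemma genfun_tendsto:
  fixes q :: complex and H :: "nat \<Rightarrow> nat \<Rightarrow> complex"
  assumes d: "d \<ge> 1" and e: "1 \<le> e" "e \<le> d" and q: "norm q < 1"
    and H: "\<And>N a. a \<le> k \<Longrightarrow> H N a = (\<Sum>(j, m)\<in>initial_pairs d (d * k + e) (d * a + e).
       q ^ ((2 * N + 1) * j + (2 * N + 2) * (d * m)) * H (Suc N) (k - m))"
    and H1: "\<And>a. a \<le> k \<Longrightarrow> (\<lambda>N. H N a) \<longlonglongrightarrow> 1" and a: "a \<le> k"
  shows "(\<lambda>L. genfun d (d * k + e) q N L (d * a + e)) \<longlonglongrightarrow> H N a"
proof -
  \<comment> \<open>Summing over all \<open>a \<le> k\<close> gives one error valid for every bound,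
    as \<open>genfun_approx\<close> requires.\<close>
  define E where "E L = (\<Sum>a\<le>k. norm (H (N + L) a - 1))" for L
  obtain C where C: "\<And>L. genfun d (d * k + e) (norm q) N L (d * a + e) \<le> C"
    using genfun_bounded[OF d, of "d * k + e" "d * a + e" "norm q" N] e q by auto
  have "(\<lambda>L. H (N + L) a) \<longlonglongrightarrow> 1" if "a \<le> k" for a
    using LIMSEQ_ignore_initial_segment[OF H1[OF that], of N] by (simp add: add.commute)
  then have "(\<lambda>L. norm (H (N + L) a - 1)) \<longlonglongrightarrow> 0" if "a \<le> k" for a
    using that by (intro tendsto_norm_zero) (simp add: LIM_zero)
  then have "E \<longlonglongrightarrow> (\<Sum>a\<le>k. 0)"
    unfolding E_def by (intro tendsto_sum) simp
  then have lim: "(\<lambda>L. E L * C) \<longlonglongrightarrow> 0"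
    by (intro tendsto_mult_left_zero) simp
  have "norm (genfun d (d * k + e) q N L (d * a + e) - H N a) \<le> E L * C" for L
  proof -
    have "norm (genfun d (d * k + e) q N L (d * a + e) - H N a)
        \<le> E L * genfun d (d * k + e) (norm q) N L (d * a + e)"
    proof (rule genfun_approx[OF d e H _ a])
      show "norm (H (N + L) b - 1) \<le> E L" if "b \<le> k" for b
        unfolding E_def using that by (intro member_le_sum) auto
    qed
    also have "\<dots> \<le> E L * C"
      using C by (intro mult_left_mono) (auto simp: E_def intro: sum_nonneg)
    finally show ?thesis .
  qed
  then have "(\<lambda>L. genfun d (d * k + e) q N L (d * a + e) - H N a) \<longlonglongrightarrow> 0"
    by (intro Lim_null_comparison[OF _ lim]) (auto intro: always_eventually)
  then show ?thesis by (rule LIM_zero_cancel)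
qed

lemma one_minus_mult_sum_power:
  fixes y :: "'a :: comm_ring_1"
  shows "(1 - y) * (\<Sum>j<n. y ^ j) = 1 - y ^ n"
  by (induction n) (simp_all add: distrib_left, simp add: algebra_simps)

text \<open>The value \<open>q = 0\<close> is excluded because the series contains inverse powers of
  \<open>r\<close>; it is treated separately in the final theorem.\<close>

locale parity_gordon =
  fixes d e k :: nat and q :: complex
  assumes d: "1 \<le> d" and e: "e = d \<or> 2 * e = d" and q0: "q \<noteq> 0" and q1: "norm q < 1"
begin

definition r where "r = q ^ d"
definition s where "s = q ^ (2 * e)"
definition w where "w N = q ^ ((2 * N + 1) * e)"
definition Y where "Y N = q ^ ((2 * N + 1) * d)"

lemma e_bounds: "1 \<le> e" "e \<le> d" using d e by auto

sublocale gordon_base k r s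
  using d e_bounds q0 q1
  by unfold_locales (auto simp: r_def s_def norm_power power_less_one_iff)

definition F where "F N a = G (w N) (Y N) (int a)"

lemma w_Suc: "w (Suc N) = w N * s" and Y_Suc: "Y (Suc N) = Y N * r\<^sup>2"
  unfolding w_def s_def Y_def r_def power_add[symmetric] power_mult[symmetric]
  by (simp_all add: algebra_simps)

lemma wY_cases: "(w N = Y N \<and> s = r\<^sup>2) \<or> (Y N = (w N)\<^sup>2 \<and> s = r)"
  using e
proof
  assume *: "e = d"
  have "w N = Y N" "s = r\<^sup>2"
    unfolding w_def Y_def s_def r_def by (simp_all add: * power_mult[symmetric] mult.commute)
  then show ?thesis by simp
next
  assume *: "2 * e = d"
  have "(2 * N + 1) * d = (2 * N + 1) * e * 2" unfolding *[symmetric] by simp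
  then show ?thesis
    using * by (simp only: w_def Y_def s_def r_def power_mult simp_thms)
qed

lemma wY_le: "norm (w N) \<le> 1" "norm (Y N) \<le> 1"
  using q1 by (simp_all add: w_def Y_def norm_power power_le_one)

lemma wY_nonzero: "w N \<noteq> 0" "Y N \<noteq> 0"
  using q0 by (simp_all add: w_def Y_def)

lemma Y_neq_one: "Y N \<noteq> 1"
  unfolding Y_def using d by (intro power_neq_one q1) simp

text \<open>Descent from the top: for \<open>i = 0\<close> the difference vanishes by
  \<open>gordon_series_top\<close>, and each use of the second order equation adds one summand.
  Writing \<open>w N / Y N\<close> keeps the exponent of \<open>Y N\<close> natural down to the
  difference between \<open>0\<close> and \<open>-1\<close>.\<close>

lemma series_difference:
  assumes "i \<le> Suc k"
  shows "G (w N) (Y N) (int (Suc k - i)) - G (w N) (Y N) (int (Suc k - i) - 1)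
    = w N / Y N * Y N ^ (Suc k - i) * (1 - Y N) * (1 - Y N * r) *
        (\<Sum>m<i. (Y N * r) ^ m * F (Suc N) (k - m))"
  using assms
proof (induction i)
  case 0
  have "int (Suc k) = int k + 1" by simp
  then show ?case using gordon_series_top[OF wY_le, of N N] by (simp add: add.commute)
next
  case (Suc i)
  let ?a = "k - i"
  let ?c = "w N * Y N ^ ?a * (1 - Y N) * (1 - Y N * r)"
  let ?T = "\<lambda>i. \<Sum>m<i. (Y N * r) ^ m * F (Suc N) (k - m)"
  have i: "i \<le> k" "Suc k - i = Suc ?a" "Suc k - Suc i = ?a" "k - ?a = i" using Suc.prems by auto
  have ia: "int (Suc ?a) - 1 = int ?a" "int (Suc ?a) = int ?a + 1" by simp_all
  have IH: "G (w N) (Y N) (int ?a + 1) - G (w N) (Y N) (int ?a) = ?c * ?T i"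
    using Suc.IH Suc.prems wY_nonzero(2)[of N] unfolding i(2) ia(1) unfolding ia(2) by simp
  have "Y N * (G (w N) (Y N) (int ?a) - G (w N) (Y N) (int ?a - 1))
     = (G (w N) (Y N) (int ?a + 1) - G (w N) (Y N) (int ?a)) + ?c * ((Y N * r) ^ i * F (Suc N) ?a)"
    using gordon_series_recurrence[OF wY_le wY_nonzero(2), of ?a N]
    unfolding i(4) F_def w_Suc Y_Suc by (simp add: algebra_simps)
  also have "\<dots> = ?c * ?T (Suc i)"
    unfolding IH by (simp add: distrib_left)
  finally have "G (w N) (Y N) (int ?a) - G (w N) (Y N) (int ?a - 1) = ?c * ?T (Suc i) / Y N"
    using wY_nonzero(2)[of N] by (simp add: field_simps)
  then show ?case unfolding i(3) by simp
qed

text \<open>Induction over the blocks: \<open>gordon_series_bottom\<close> handles the first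
  \<open>e\<close> rows, and each step adds \<open>d\<close> rows. The factor
  \<open>1 - q ^ (2 * N + 1)\<close> turns the geometric sums into \<open>1 - w N\<close> and
  \<open>1 - Y N\<close>.\<close>

lemma F_recurrence:
  assumes "a \<le> k"
  shows "F N a = (\<Sum>(j, m)\<in>initial_pairs d (d * k + e) (d * a + e).
     (q ^ (2 * N + 1)) ^ j * ((1 - q ^ (2 * N + 1)) * (1 - Y N * r) * ((Y N * r) ^ m * F (Suc N) (k - m))))"
  using assms
proof (induction a)
  let ?y = "q ^ (2 * N + 1)"
  let ?T = "\<lambda>i. \<Sum>m<i. (Y N * r) ^ m * F (Suc N) (k - m)"
  let ?X = "\<lambda>m. (1 - ?y) * (1 - Y N * r) * ((Y N * r) ^ m * F (Suc N) (k - m))"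
  have S: "(\<Sum>m<i. ?X m) = (1 - ?y) * (1 - Y N * r) * ?T i" for i
    by (simp only: sum_distrib_left)
  {
    case 0
    have w: "w N = ?y ^ e" by (simp only: w_def power_mult)
    have "w N * (1 - Y N) * F N 0 = (1 - w N) * Y N * (G (w N) (Y N) 0 - G (w N) (Y N) (-1))"
      unfolding F_def of_nat_0 by (rule gordon_series_bottom[OF wY_le wY_nonzero(2) wY_cases])
    also have "G (w N) (Y N) 0 - G (w N) (Y N) (-1)
       = w N / Y N * (1 - Y N) * (1 - Y N * r) * ?T (Suc k)"
      using series_difference[of "Suc k" N] by simp
    also have "(1 - w N) * Y N * \<dots> = w N * (1 - Y N) * ((1 - w N) * (1 - Y N * r) * ?T (Suc k))"
      using wY_nonzero(2)[of N] by (simp add: field_simps)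
    finally have "F N 0 = (1 - w N) * (1 - Y N * r) * ?T (Suc k)"
      using wY_nonzero(1)[of N] Y_neq_one[of N] by simp
    also have "1 - w N = (1 - ?y) * (\<Sum>j<e. ?y ^ j)"
      unfolding w one_minus_mult_sum_power ..
    also have "\<dots> * (1 - Y N * r) * ?T (Suc k) = (\<Sum>j<e. ?y ^ j) * (\<Sum>m<Suc k. ?X m)"
      unfolding S by (simp only: mult_ac)
    finally show ?case
      using sum_initial_pairs_base[OF d e_bounds(2), where y = ?y and X = ?X and k = k]
      by (simp only: mult_0_right add_0_left)
  next
    case (Suc a)
    have eq: "d * a + e + d = d * Suc a + e" by simp
    have a: "Suc k - (k - a) = Suc a" "int (Suc a) - 1 = int a" using Suc.prems by auto
    have "F N (Suc a) - F N a = w N / Y N * Y N ^ Suc a * (1 - Y N) * (1 - Y N * r) * ?T (k - a)"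
      using series_difference[of "k - a" N] unfolding F_def a(1) a(2) by simp
    also have "\<dots> = w N * Y N ^ a * (1 - Y N) * (1 - Y N * r) * ?T (k - a)"
      using wY_nonzero(2)[of N] by simp
    also have "w N * Y N ^ a = ?y ^ (d * a + e)"
      by (simp only: w_def Y_def power_mult[symmetric] power_add[symmetric]) (simp add: algebra_simps)
    also have "1 - Y N = (1 - ?y) * (\<Sum>j<d. ?y ^ j)"
      unfolding one_minus_mult_sum_power Y_def power_mult ..
    finally have "F N (Suc a) = F N a + ?y ^ (d * a + e) * (\<Sum>j<d. ?y ^ j) * (\<Sum>m<k - a. ?X m)"
      unfolding S by (simp add: algebra_simps)
    then show ?case
      using sum_initial_pairs_step[OF d, of a k d, where y = ?y and X = ?X and e = e] Suc
      unfolding eq by simp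
  }
qed

text \<open>The quotient \<open>prefactor N / den\<close> is the reciprocal of the tail product.
  Passing to the next level multiplies \<open>prefactor\<close> by exactly the two extra factors in
  \<open>F_recurrence\<close>, so \<open>H\<close> satisfies the recurrence of
  \<open>genfun\<close>.\<close>

definition "prefactor N = qpoch q (q\<^sup>2) N * qpoch (q ^ (2 * d)) (q ^ (2 * d)) N"
definition "den = qpoch_inf (q ^ (2 * d)) (q ^ (2 * d)) * qpoch_inf q (q\<^sup>2)"
definition "H N a = prefactor N * F N a / den"

lemma den_nonzero: "den \<noteq> 0"
proof -
  have "q * (q\<^sup>2) ^ i \<noteq> 1" for i
    using power_neq_one[OF q1, of "2 * i + 1"] by (simp add: power_mult)
  moreover have "q ^ (2 * d) * (q ^ (2 * d)) ^ i \<noteq> 1" for i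
    using power_neq_one[OF q1, of "2 * d * Suc i"] d
    by (simp only: power_mult power_Suc) simp
  ultimately show ?thesis
    unfolding den_def using q1 d
    by (intro no_zero_divisors qpoch_inf_nonzero) (auto simp: norm_power power_less_one_iff)
qed

lemma prefactor_Suc: "prefactor (Suc N) = prefactor N * ((1 - q ^ (2 * N + 1)) * (1 - Y N * r))"
proof -
  have "q * (q\<^sup>2) ^ N = q ^ (2 * N + 1)" by (simp add: power_mult)
  moreover have "q ^ (2 * d) * (q ^ (2 * d)) ^ N = Y N * r"
    unfolding Y_def r_def power_mult[symmetric] power_add[symmetric] by (simp add: algebra_simps)
  ultimately show ?thesis
    unfolding prefactor_def qpoch_Suc by (simp only: mult_ac)
qed

lemma prefactor_tendsto: "prefactor \<longlonglongrightarrow> den"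
proof -
  have "prefactor \<longlonglongrightarrow> qpoch_inf q (q\<^sup>2) * qpoch_inf (q ^ (2 * d)) (q ^ (2 * d))"
    unfolding prefactor_def using q1 d
    by (intro tendsto_mult qpoch_tendsto) (auto simp: norm_power power_less_one_iff)
  then show ?thesis by (simp add: den_def mult.commute)
qed

lemma H_recurrence:
  assumes "a \<le> k"
  shows "H N a = (\<Sum>(j, m)\<in>initial_pairs d (d * k + e) (d * a + e).
       q ^ ((2 * N + 1) * j + (2 * N + 2) * (d * m)) * H (Suc N) (k - m))"
proof -
  have "q ^ ((2 * N + 1) * j + (2 * N + 2) * (d * m)) = (q ^ (2 * N + 1)) ^ j * (Y N * r) ^ m" for j m
    unfolding Y_def r_def power_mult[symmetric] power_add[symmetric] by (simp add: algebra_simps)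
  then show ?thesis
    unfolding H_def F_recurrence[OF assms] prefactor_Suc sum_distrib_left sum_divide_distrib
    by (intro sum.cong) (auto simp: mult_ac)
qed

lemma H_tendsto: "(\<lambda>N. H N a) \<longlonglongrightarrow> 1"
proof -
  obtain C where C: "\<And>w Y. norm w \<le> 1 \<Longrightarrow> norm Y \<le> 1 \<Longrightarrow> norm (G w Y (int a) - 1) \<le> C * norm w"
    using gordon_series_near_one[of a] by blast
  have "w = (\<lambda>N. q ^ e * (q ^ (2 * e)) ^ N)"
    unfolding w_def power_mult[symmetric] power_add[symmetric] by (simp add: algebra_simps)
  moreover have "(\<lambda>N. q ^ e * (q ^ (2 * e)) ^ N) \<longlonglongrightarrow> 0"
    using q1 e_bounds by (intro tendsto_mult_right_zero LIMSEQ_power_zero) (auto simp: norm_power power_less_one_iff)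
  ultimately have "(\<lambda>N. C * norm (w N)) \<longlonglongrightarrow> 0"
    by (intro tendsto_mult_right_zero tendsto_norm_zero) simp
  then have "(\<lambda>N. F N a - 1) \<longlonglongrightarrow> 0"
    by (rule Lim_null_comparison[rotated]) (auto simp: F_def intro!: always_eventually C wY_le)
  then have "(\<lambda>N. F N a) \<longlonglongrightarrow> 1" by (rule LIM_zero_cancel)
  then have "(\<lambda>N. H N a) \<longlonglongrightarrow> den * 1 / den"
    unfolding H_def by (intro tendsto_intros prefactor_tendsto den_nonzero)
  then show ?thesis using den_nonzero by simp
qed

section \<open>Evaluation at level zero, where \<open>Y 0 = r\<close> cancels
  \<open>1 - Y * r ^ n\<close> against \<open>1 - r ^ Suc n\<close> and leaves a theta
  series\<close>

lemma gordon_coeff_at_origin: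
  "al (w 0) (Y 0) n = (-1) ^ n * (q ^ (2 * d * k + 2 * e + d)) ^ (Suc n choose 2) * inverse (q ^ e) ^ n"
proof (induction n)
  case 0
  then show ?case by (simp add: binomial_eq_0)
next
  case (Suc n)
  let ?M = "2 * d * k + 2 * e + d"
  have nz: "1 - r ^ Suc n \<noteq> 0" using r_power_neq_one[of "Suc n"] by auto
  have Y: "Y 0 = r" by (simp add: Y_def r_def)
  have "w 0 * r ^ k * s ^ n * r ^ (k * (2 * n + 1) + n + 1) * q ^ e = (q ^ ?M) ^ Suc n"
    unfolding w_def r_def s_def power_mult[symmetric] power_add[symmetric] by (simp add: algebra_simps)
  then have "w 0 * r ^ k * s ^ n * r ^ (k * (2 * n + 1) + n + 1) = (q ^ ?M) ^ Suc n * inverse (q ^ e)"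
    using q0 by (simp add: field_simps)
  then have "al (w 0) (Y 0) (Suc n) = al (w 0) (Y 0) n * - ((q ^ ?M) ^ Suc n * inverse (q ^ e))"
    unfolding gordon_coeff.simps Y using nz by simp
  then show ?case
    unfolding Suc choose_two_Suc[of "Suc n"] power_add[of _ "Suc n choose 2"] by simp
qed

lemma F_0_eq:
  assumes "a \<le> k"
  shows "F 0 a = qpoch_inf (q ^ (d * a + e)) (q ^ (2 * d * k + 2 * e + d))
     * qpoch_inf (q ^ (2 * d * k + 2 * e + d - (d * a + e))) (q ^ (2 * d * k + 2 * e + d))
     * qpoch_inf (q ^ (2 * d * k + 2 * e + d)) (q ^ (2 * d * k + 2 * e + d))"
proof -
  let ?p = "q ^ (2 * d * k + 2 * e + d)" and ?z = "q ^ (d * a + e)"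
  have "d * a \<le> d * k" using assms by simp
  then have le: "d * a + e \<le> 2 * d * k + 2 * e + d" by linarith
  have "gt (w 0) (Y 0) (int a) n = (-1) ^ n * ?p ^ (Suc n choose 2) * (inverse ?z ^ n - ?z ^ Suc n)" for n
  proof -
    have 1: "inverse (q ^ e) ^ n * (inverse r ^ n) ^ a = inverse ?z ^ n"
      unfolding r_def power_inverse inverse_mult_distrib[symmetric] power_mult[symmetric] power_add[symmetric]
      by (simp add: algebra_simps)
    have "w 0 * s ^ n * (Y 0 * r ^ n) ^ a = (q ^ e) ^ n * ?z ^ Suc n"
      unfolding w_def r_def s_def Y_def power_mult[symmetric] power_add[symmetric] power_mult_distrib
      by (rule arg_cong[of _ _ "(^) q"]) (simp add: algebra_simps)
    then have 2: "inverse (q ^ e) ^ n * (w 0 * s ^ n * (Y 0 * r ^ n) ^ a) = ?z ^ Suc n"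
      using q0 by (simp add: power_inverse)
    have "gt (w 0) (Y 0) (int a) n = (-1) ^ n * ?p ^ (Suc n choose 2) *
       (inverse (q ^ e) ^ n * (inverse r ^ n) ^ a - inverse (q ^ e) ^ n * (w 0 * s ^ n * (Y 0 * r ^ n) ^ a))"
      unfolding gordon_term_def gordon_coeff_at_origin power_int_of_nat
      by (simp only: right_diff_distrib mult.assoc)
    then show ?thesis unfolding 1 2 .
  qed
  then have "F 0 a = (\<Sum>n. (-1) ^ n * ?p ^ (Suc n choose 2) * (inverse ?z ^ n - ?z ^ Suc n))"
    by (simp only: F_def gordon_series_def)
  also have "\<dots> = qpoch_inf ?z ?p * qpoch_inf (?p / ?z) ?p * qpoch_inf ?p ?p"
    using q0 q1 d by (intro jacobi_triple_product) (auto simp: norm_power power_less_one_iff)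
  also have "?p / ?z = q ^ (2 * d * k + 2 * e + d - (d * a + e))"
    by (rule power_diff[symmetric, OF q0 le])
  finally show ?thesis .
qed

text \<open>The recurrence at level 0 with an arbitrary bound \<open>A\<close>; from level 1 on only
  bounds \<open>d * a + e\<close> occur, where \<open>H\<close> is available.\<close>

definition V where "V A = (\<Sum>(j, m)\<in>initial_pairs d (d * k + e) A.
       q ^ j * (q ^ (2 * d * m) * H (Suc 0) (k - m)))"

lemma power_first_row: "q ^ ((2 * 0 + 1) * j + (2 * 0 + 2) * (d * m)) = q ^ j * q ^ (2 * d * m)"
  unfolding power_add[symmetric] by (rule arg_cong[of _ _ "(^) q"]) simp

lemma genfun_tendsto_V: "(\<lambda>L. genfun d (d * k + e) q 0 L A) \<longlonglongrightarrow> V A"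
proof -
  have lim: "(\<lambda>L. genfun d (d * k + e) q (Suc 0) L (d * (k - m) + e)) \<longlonglongrightarrow> H (Suc 0) (k - m)" for m
    by (rule genfun_tendsto[OF d e_bounds q1 H_recurrence H_tendsto]) simp_all
  have le: "d * k + e - d * m = d * (k - m) + e" if "(j, m) \<in> initial_pairs d (d * k + e) A" for j m
  proof -
    have "m \<le> k"
    proof (rule ccontr)
      assume "\<not> m \<le> k"
      then have "d * Suc k \<le> d * m" by (intro mult_le_mono2) simp
      moreover have "j + d * m < d * k + e" using that by (simp add: initial_pairs_def)
      ultimately show False using e_bounds by simp
    qed
    then show ?thesis by (simp add: diff_mult_distrib2)
  qed
  have "(\<lambda>L. genfun d (d * k + e) q 0 (Suc L) A) = (\<lambda>L. \<Sum>(j, m)\<in>initial_pairs d (d * k + e) A.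
      q ^ j * (q ^ (2 * d * m) * genfun d (d * k + e) q (Suc 0) L (d * (k - m) + e)))"
    unfolding genfun_Suc[OF d] power_first_row
    by (rule ext, rule sum.cong) (auto simp: le mult.assoc)
  moreover have "\<dots> \<longlonglongrightarrow> V A"
    unfolding V_def case_prod_unfold by (intro tendsto_sum tendsto_mult tendsto_const lim)
  ultimately have "(\<lambda>L. genfun d (d * k + e) q 0 (Suc L) A) \<longlonglongrightarrow> V A" by (simp only:)
  then show ?thesis by (rule LIMSEQ_imp_Suc)
qed

lemma V_eq_H: "a \<le> k \<Longrightarrow> V (d * a + e) = H 0 a"
  unfolding V_def H_recurrence[of a 0] power_first_row by (simp only: mult.assoc)

text \<open>Raising the bound by \<open>c\<close> or by \<open>d\<close> adds the same quantity
  \<open>x * S / (1 - q)\<close> times \<open>1 - q ^ c\<close> or \<open>1 - q ^ d\<close>;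
  eliminating \<open>S\<close> gives the weights.\<close>

lemma V_interpolation:
  assumes "a \<le> k" "c \<le> d"
  shows "V (d * a + e + c) = (q ^ c - q ^ d) / (1 - q ^ d) * V (d * a + e)
     + (1 - q ^ c) / (1 - q ^ d) * V (d * (a + 1) + e)"
proof -
  define S where "S = (\<Sum>m<k - a. q ^ (2 * d * m) * H (Suc 0) (k - m))"
  define x where "x = q ^ (d * a + e)"
  have nz: "1 - q \<noteq> 0" "1 - q ^ d \<noteq> 0"
    using power_neq_one[OF q1, of 1] power_neq_one[OF q1, of d] d by auto
  have sum: "(\<Sum>j<n. q ^ j) = (1 - q ^ n) / (1 - q)" for n
    using one_minus_mult_sum_power[of q n] nz by (simp add: field_simps)
  have step: "V (d * a + e + n) = V (d * a + e) + x * ((1 - q ^ n) / (1 - q)) * S" if "n \<le> d" for n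
    unfolding V_def S_def x_def sum[symmetric] by (rule sum_initial_pairs_step[OF d assms(1) that])
  have "d * (a + 1) + e = d * a + e + d" by simp
  then have top: "V (d * (a + 1) + e) = V (d * a + e) + x * ((1 - q ^ d) / (1 - q)) * S"
    by (simp only: step[OF order.refl])
  have "v + x * ((1 - u) / (1 - q)) * S = (u - t) / (1 - t) * v + (1 - u) / (1 - t) * (v + x * ((1 - t) / (1 - q)) * S)"
    if "1 - t \<noteq> 0" for u t v
    using that nz(1) by (simp add: divide_simps) (simp add: algebra_simps)
  then show ?thesis
    unfolding step[OF assms(2)] top using nz(2) by blast
qed

text \<open>Allows interpolation above the last block, needed when \<open>a = k\<close> and
  \<open>f > e\<close>.\<close>

lemma V_top: "V (d * (k + 1) + e) = V (d * k + e)"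
proof -
  have "d * (k + 1) + e = d * k + e + d" by simp
  then show ?thesis
    unfolding V_def
    using sum_initial_pairs_step[where d = d and a = k and k = k and c = d and e = e and y = q
        and X = "\<lambda>m. q ^ (2 * d * m) * H (Suc 0) (k - m)", OF d order.refl order.refl]
    by (simp only: diff_self_eq_0 lessThan_0 sum.empty mult_zero_right add_0_right)
qed

text \<open>For \<open>a = Suc k\<close> the two exponents are those of \<open>a = k\<close>
  exchanged, and the product is symmetric in them.\<close>

lemma V_eq:
  assumes "a \<le> Suc k"
  shows "V (d * a + e) = qpoch_inf (q ^ (d * a + e)) (q ^ (2 * d * k + 2 * e + d))
     * qpoch_inf (q ^ (2 * d * k + 2 * e + d - (d * a + e))) (q ^ (2 * d * k + 2 * e + d))
     * qpoch_inf (q ^ (2 * d * k + 2 * e + d)) (q ^ (2 * d * k + 2 * e + d)) / den"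
proof -
  have H0: "H 0 a = F 0 a / den" for a by (simp add: H_def prefactor_def)
  show ?thesis
  proof (cases "a \<le> k")
    case True
    then show ?thesis by (simp only: V_eq_H H0 F_0_eq)
  next
    case False
    then have a: "a = k + 1" using assms by simp
    have "2 * d * k + 2 * e + d - (d * (k + 1) + e) = d * k + e"
         "2 * d * k + 2 * e + d - (d * k + e) = d * (k + 1) + e" by simp_all
    then show ?thesis
      unfolding a V_top V_eq_H[OF order.refl] H0 F_0_eq[OF order.refl] by (simp only: mult_ac)
  qed
qed

end

lemma qpoch_inf_zero: "qpoch_inf 0 q = 1"
  by (simp add: qpoch_inf_def)

lemma dB_0:
  assumes "A \<ge> 1" "K \<ge> 1"
  shows "dB d K A 0 = 1"
proof -
  have "dB_set d K A 0 = {\<lambda>_. 0}"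
    using admissible_eq_dB_set[of 0 0 d K A] admissible_0[OF assms, of d 0]
    by (auto simp: size_upto_def)
  then show ?thesis by (simp add: dB_eq_card)
qed

theorem theorem3p1:
  fixes a k d e f :: nat and q :: complex
  assumes "1 \<le> a" "a \<le> k" "1 \<le> d" "d \<le> k" "1 \<le> f" "f \<le> d"
    and "e = d \<or> 2 * e = d"
    and "norm q < 1"
  defines "M \<equiv> 2*d*k + 2*e + d"
  defines "P \<equiv> (\<lambda>x y :: nat. qpoch_inf (q ^ x) (q ^ M) * qpoch_inf (q ^ y) (q ^ M)
                     * qpoch_inf (q ^ M) (q ^ M))"
  defines "D \<equiv> qpoch_inf (q ^ (2*d)) (q ^ (2*d)) * qpoch_inf q (q ^ 2)"
  shows "(\<lambda>n. of_nat (dB d (d*k + e) (d*a + f) n) * q ^ n) sums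
     (if f < e then
        (1 / D) * ((1 - q ^ (d - e + f)) / (1 - q ^ d) * P (d*a + e) (2*d*k - d*a + e + d)
                 + (q ^ (d - e + f) - q ^ d) / (1 - q ^ d) * P (d*(a - 1) + e) (2*d*k - d*a + e + 2*d))
      else if f = e then
        P (d*a + e) (2*d*k - d*a + e + d) / D
      else
        (1 / D) * ((q ^ (f - e) - q ^ d) / (1 - q ^ d) * P (d*a + e) (2*d*k - d*a + e + d)
                 + (1 - q ^ (f - e)) / (1 - q ^ d) * P (d*(a + 1) + e) (2*d*k - d*a + e)))"
    (is "_ sums ?rhs")
proof (cases "q = 0")
  \<comment> \<open>At \<open>q = 0\<close> both sides reduce to the constant term 1, since all
    exponents in question are positive.\<close>
  case True
  have e1: "e \<ge> 1" using assms by auto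
  have "M \<noteq> 0" using assms(3) by (simp add: M_def)
  then have P: "P x y = 1" if "x > 0" "y > 0" for x y
    using that by (simp add: P_def True qpoch_inf_zero zero_power)
  have D: "D = 1" using assms(3) by (simp add: D_def True qpoch_inf_zero zero_power)
  have "?rhs = 1"
    using e1 assms(3) by (simp add: P D True power_0_left)
  moreover have "dB d (d*k + e) (d*a + f) 0 = 1"
    using e1 assms by (intro dB_0) auto
  ultimately show ?thesis
    using powser_sums_zero[of "\<lambda>n. of_nat (dB d (d*k + e) (d*a + f) n) :: complex"]
    by (simp only: True of_nat_1)
next
  case False
  interpret parity_gordon d e k q
    using assms False by unfold_locales
  have DD: "den = D" by (simp only: D_def den_def)
  have le: "d * a \<le> d * k" using assms(2) by simp
  have V: "V (d * b + e) = P (d * b + e) (M - (d * b + e)) / D" if "b \<le> Suc k" for b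
    unfolding V_eq[OF that] DD P_def M_def ..
  have "M - (d * a + e) = 2*d*k - d*a + e + d"
    unfolding M_def using le by linarith
  then have Va: "V (d * a + e) = P (d * a + e) (2*d*k - d*a + e + d) / D"
    using V[of a] assms(2) by simp
  have lin: "u * (x / D) + v * (y / D) = (1 / D) * (u * x + v * y)" for u v x y
    by (simp add: add_divide_distrib)
  have "V (d * a + f) = ?rhs"
  proof -
    consider "f < e" | "f = e" | "f > e" by linarith
    then show ?thesis
    proof cases
      case 1
      obtain b where b: "a = Suc b" using assms(1) by (cases a) auto
      have da: "d * a = d * b + d" by (simp add: b)
      \<comment> \<open>For \<open>f < e\<close> the bound lies in the block below
        \<open>d * a + e\<close>, at offset \<open>d - e + f\<close> from its start
        \<open>d * (a - 1) + e\<close>.\<close>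
      have eq: "d * a + f = d * b + e + (d - e + f)"
        unfolding da using e_bounds by linarith
      have "M - (d * b + e) = 2*d*k - d*a + e + 2*d"
        unfolding M_def using le da by linarith
      then have Vb: "V (d * b + e) = P (d * (a - 1) + e) (2*d*k - d*a + e + 2*d) / D"
        using V[of b] assms(2) by (simp add: b)
      have "V (d * b + e + (d - e + f)) = (q ^ (d - e + f) - q ^ d) / (1 - q ^ d) * V (d * b + e)
          + (1 - q ^ (d - e + f)) / (1 - q ^ d) * V (d * (b + 1) + e)"
        using assms(2) e_bounds 1 by (intro V_interpolation) (auto simp: b)
      also have "b + 1 = a" by (simp add: b)
      finally have "V (d * a + f) = (1 - q ^ (d - e + f)) / (1 - q ^ d) * V (d * a + e)
          + (q ^ (d - e + f) - q ^ d) / (1 - q ^ d) * V (d * b + e)"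
        unfolding eq[symmetric] by (simp only: add.commute)
      also have "\<dots> = ?rhs"
        unfolding Va Vb lin using 1 by (simp only: if_True)
      finally show ?thesis .
    next
      case 2
      then show ?thesis using Va by simp
    next
      case 3
      have eq: "d * a + f = d * a + e + (f - e)" using 3 by simp
      have da: "d * (a + 1) = d * a + d" by simp
      have "M - (d * (a + 1) + e) = 2*d*k - d*a + e"
        unfolding M_def da using le by linarith
      then have Vb: "V (d * (a + 1) + e) = P (d * (a + 1) + e) (2*d*k - d*a + e) / D"
        using V[of "a + 1"] assms(2) by simp
      have "V (d * a + f) = (q ^ (f - e) - q ^ d) / (1 - q ^ d) * V (d * a + e)
          + (1 - q ^ (f - e)) / (1 - q ^ d) * V (d * (a + 1) + e)"
        unfolding eq by (rule V_interpolation) (use assms(2,6) in auto)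
      also have "\<dots> = ?rhs"
      proof -
        have "\<not> f < e" "f \<noteq> e" using 3 by auto
        then show ?thesis unfolding Va Vb lin by (simp only: if_False)
      qed
      finally show ?thesis .
    qed
  qed
  moreover have "(\<lambda>n. of_nat (dB d (d*k + e) (d*a + f) n) * q ^ n) sums V (d * a + f)"
    using assms e_bounds by (intro dB_sums genfun_tendsto_V) auto
  ultimately show ?thesis by (simp only:)
qed

end
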